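(* There exist countable $\omega$-categorical structures $\mathcal{A}$ and $\mathcal{B}$ such that the endomorphism monoids $\operatorname{End}(\mathcal{A})$ and $\operatorname{End}(\mathcal{B})$ are isomorphic as abstract monoids, but are not topologically isomorphic, i.e., no monoid isomorphism $\operatorname{End}(\mathcal{A}) \to \operatorname{End}(\mathcal{B})$ is a homeomorphism.
   Context: A countable structure $\mathcal{A}$ is $\omega$-categorical if all countable models of its first-order theory are isomorphic; equivalently (Ryll-Nardzewski), $\operatorname{Aut}(\mathcal{A})$ is oligomorphic, that is, for every $k\ge 1$ it has only finitely many orbits in its componentwise action on $k$-tuples of elements of $\mathcal{A}$. $\operatorname{End}(\mathcal{A})$ is the monoid of all homomorphisms from $\mathcal{A}$ to $\mathcal{A}$ under composition. If $X$ is the domain of $\mathcal{A}$, it carries the topology of pointwise convergence, i.e., the subspace topology inherited from $X^X$, where $X$ is discrete and $X^X$ has the product topology; with it $\operatorname{End}(\mathcal{A})$ is a topological monoid. *)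

theory Defs
  imports "HOL-Analysis.Function_Topology" "HOL-Algebra.Group"
begin

text \<open>
  Signatures have function and relation symbols of arbitrary finite arity; constants are
  function symbols of arity 0. A symbol belongs to the signature iff it has an arity.
\<close>

record ('f, 'r) signature =
  fun_arity :: "'f \<Rightarrow> nat option"
  rel_arity :: "'r \<Rightarrow> nat option"

record ('f, 'r, 'a) fo_structure =
  universe :: "'a set"
  fun_interp :: "'f \<Rightarrow> 'a list \<Rightarrow> 'a"
  rel_interp :: "'r \<Rightarrow> 'a list set"

definition is_structure :: "('f, 'r) signature \<Rightarrow> ('f, 'r, 'a) fo_structure \<Rightarrow> bool" where
  "is_structure S A \<longleftrightarrow>
     universe A \<noteq> {} \<and>
     (\<forall>f n xs. fun_arity S f = Some n \<longrightarrow> length xs = n \<longrightarrow> set xs \<subseteq> universe A \<longrightarrow>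
        fun_interp A f xs \<in> universe A) \<and>
     (\<forall>r n. rel_arity S r = Some n \<longrightarrow>
        rel_interp A r \<subseteq> {xs. length xs = n \<and> set xs \<subseteq> universe A})"

definition structure_hom ::
  "('f, 'r) signature \<Rightarrow> ('f, 'r, 'a) fo_structure \<Rightarrow> ('f, 'r, 'b) fo_structure \<Rightarrow> ('a \<Rightarrow> 'b) \<Rightarrow> bool"
where
  "structure_hom S A B h \<longleftrightarrow>
     h \<in> universe A \<rightarrow> universe B \<and>
     (\<forall>f n xs. fun_arity S f = Some n \<longrightarrow> length xs = n \<longrightarrow> set xs \<subseteq> universe A \<longrightarrow>
        h (fun_interp A f xs) = fun_interp B f (map h xs)) \<and>
     (\<forall>r n xs. rel_arity S r = Some n \<longrightarrow> length xs = n \<longrightarrow> set xs \<subseteq> universe A \<longrightarrow>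
        xs \<in> rel_interp A r \<longrightarrow> map h xs \<in> rel_interp B r)"

definition structure_iso ::
  "('f, 'r) signature \<Rightarrow> ('f, 'r, 'a) fo_structure \<Rightarrow> ('f, 'r, 'b) fo_structure \<Rightarrow> ('a \<Rightarrow> 'b) \<Rightarrow> bool"
where
  "structure_iso S A B h \<longleftrightarrow>
     structure_hom S A B h \<and> bij_betw h (universe A) (universe B) \<and>
     (\<forall>r n xs. rel_arity S r = Some n \<longrightarrow> length xs = n \<longrightarrow> set xs \<subseteq> universe A \<longrightarrow>
        map h xs \<in> rel_interp B r \<longrightarrow> xs \<in> rel_interp A r)"

datatype 'f trm = Var nat | Fun 'f "'f trm list"

datatype ('f, 'r) fm =
    Equal "'f trm" "'f trm"
  | Rel 'r "'f trm list"
  | Neg "('f, 'r) fm"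
  | Conj "('f, 'r) fm" "('f, 'r) fm"
  | Exist nat "('f, 'r) fm"

primrec wf_trm :: "('f, 'r) signature \<Rightarrow> 'f trm \<Rightarrow> bool" where
  "wf_trm S (Var x) \<longleftrightarrow> True"
| "wf_trm S (Fun f ts) \<longleftrightarrow> fun_arity S f = Some (length ts) \<and> list_all (wf_trm S) ts"

primrec wf_fm :: "('f, 'r) signature \<Rightarrow> ('f, 'r) fm \<Rightarrow> bool" where
  "wf_fm S (Equal s t) \<longleftrightarrow> wf_trm S s \<and> wf_trm S t"
| "wf_fm S (Rel r ts) \<longleftrightarrow> rel_arity S r = Some (length ts) \<and> list_all (wf_trm S) ts"
| "wf_fm S (Neg p) \<longleftrightarrow> wf_fm S p"
| "wf_fm S (Conj p q) \<longleftrightarrow> wf_fm S p \<and> wf_fm S q"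
| "wf_fm S (Exist x p) \<longleftrightarrow> wf_fm S p"

primrec vars_trm :: "'f trm \<Rightarrow> nat set" where
  "vars_trm (Var x) = {x}"
| "vars_trm (Fun f ts) = \<Union>(set (map vars_trm ts))"

primrec free_vars :: "('f, 'r) fm \<Rightarrow> nat set" where
  "free_vars (Equal s t) = vars_trm s \<union> vars_trm t"
| "free_vars (Rel r ts) = \<Union>(set (map vars_trm ts))"
| "free_vars (Neg p) = free_vars p"
| "free_vars (Conj p q) = free_vars p \<union> free_vars q"
| "free_vars (Exist x p) = free_vars p - {x}"

primrec eval_trm :: "('f, 'r, 'a) fo_structure \<Rightarrow> (nat \<Rightarrow> 'a) \<Rightarrow> 'f trm \<Rightarrow> 'a" where
  "eval_trm A v (Var x) = v x"
| "eval_trm A v (Fun f ts) = fun_interp A f (map (eval_trm A v) ts)"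

primrec satisfies :: "('f, 'r, 'a) fo_structure \<Rightarrow> (nat \<Rightarrow> 'a) \<Rightarrow> ('f, 'r) fm \<Rightarrow> bool" where
  "satisfies A v (Equal s t) \<longleftrightarrow> eval_trm A v s = eval_trm A v t"
| "satisfies A v (Rel r ts) \<longleftrightarrow> map (eval_trm A v) ts \<in> rel_interp A r"
| "satisfies A v (Neg p) \<longleftrightarrow> \<not> satisfies A v p"
| "satisfies A v (Conj p q) \<longleftrightarrow> satisfies A v p \<and> satisfies A v q"
| "satisfies A v (Exist x p) \<longleftrightarrow> (\<exists>a\<in>universe A. satisfies A (v(x := a)) p)"

definition sentence :: "('f, 'r) signature \<Rightarrow> ('f, 'r) fm \<Rightarrow> bool" where
  "sentence S p \<longleftrightarrow> wf_fm S p \<and> free_vars p = {}"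

text \<open>The truth value of a sentence does not depend on the valuation.\<close>

definition holds :: "('f, 'r, 'a) fo_structure \<Rightarrow> ('f, 'r) fm \<Rightarrow> bool" where
  "holds A p \<longleftrightarrow> (\<forall>v. range v \<subseteq> universe A \<longrightarrow> satisfies A v p)"

definition theory_of :: "('f, 'r) signature \<Rightarrow> ('f, 'r, 'a) fo_structure \<Rightarrow> ('f, 'r) fm set" where
  "theory_of S A = {p. sentence S p \<and> holds A p}"

definition is_model ::
  "('f, 'r) signature \<Rightarrow> ('f, 'r) fm set \<Rightarrow> ('f, 'r, 'a) fo_structure \<Rightarrow> bool" where
  "is_model S T A \<longleftrightarrow> is_structure S A \<and> (\<forall>p\<in>T. holds A p)"

text \<open>
  Countable means finite or countably infinite. HOL cannot quantify over types inside a formula,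
  so the countable models range over the structures whose universe is a set of natural numbers;
  every countable structure is isomorphic to one of these.
\<close>

definition omega_categorical ::
  "('f, 'r) signature \<Rightarrow> ('f, 'r, 'a) fo_structure \<Rightarrow> bool" where
  "omega_categorical S A \<longleftrightarrow>
     is_structure S A \<and> countable (universe A) \<and>
     (\<forall>(M :: ('f, 'r, nat) fo_structure) (N :: ('f, 'r, nat) fo_structure).
        is_model S (theory_of S A) M \<longrightarrow> is_model S (theory_of S A) N \<longrightarrow>
        (\<exists>h. structure_iso S M N h))"

text \<open>
  Self-maps of the universe are represented by extensional functions, so that distinct elements
  of the carrier are distinct maps; this is also the convention of \<^const>\<open>product_topology\<close>.
  The elements of \<^const>\<open>iso\<close> between two such monoids are the monoid isomorphisms:
  a surjective multiplicative map between monoids preserves the unit.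
\<close>

definition End_monoid ::
  "('f, 'r) signature \<Rightarrow> ('f, 'r, 'a) fo_structure \<Rightarrow> ('a \<Rightarrow> 'a) monoid" where
  "End_monoid S A =
     \<lparr>carrier = {h \<in> extensional (universe A). structure_hom S A A h},
      mult = compose (universe A),
      one = (\<lambda>x\<in>universe A. x)\<rparr>"

definition End_topology ::
  "('f, 'r) signature \<Rightarrow> ('f, 'r, 'a) fo_structure \<Rightarrow> ('a \<Rightarrow> 'a) topology" where
  "End_topology S A =
     subtopology (product_topology (\<lambda>_. discrete_topology (universe A)) (universe A))
       (carrier (End_monoid S A))"

lemma topspace_End_topology: "topspace (End_topology S A) = carrier (End_monoid S A)"
  by (auto simp: End_topology_def End_monoid_def structure_hom_def PiE_def)

lemma monoid_End_monoid:
  assumes "is_structure S A"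
  shows "monoid (End_monoid S A)"
proof (rule monoidI)
  show "\<one>\<^bsub>End_monoid S A\<^esub> \<in> carrier (End_monoid S A)"
  proof -
    have "map (\<lambda>x\<in>universe A. x) xs = xs" if "set xs \<subseteq> universe A" for xs
      using that by (intro map_idI) auto
    then show ?thesis
      using assms by (auto simp: End_monoid_def structure_hom_def is_structure_def)
  qed
next
  fix g h
  assume g: "g \<in> carrier (End_monoid S A)" and h: "h \<in> carrier (End_monoid S A)"
  have map_in: "set (map h xs) \<subseteq> universe A" if "set xs \<subseteq> universe A" for xs
    using h that by (auto simp: End_monoid_def structure_hom_def)
  have map_compose: "map (compose (universe A) g h) xs = map g (map h xs)"
    if "set xs \<subseteq> universe A" for xs
    using that by (auto simp: compose_def)
  have fun_in: "fun_interp A f xs \<in> universe A"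
    if "fun_arity S f = Some (length xs)" "set xs \<subseteq> universe A" for f xs
    using assms that by (auto simp: is_structure_def)
  have "structure_hom S A A (compose (universe A) g h)"
    unfolding structure_hom_def
  proof (intro conjI allI impI)
    show "compose (universe A) g h \<in> universe A \<rightarrow> universe A"
      using g h by (auto simp: End_monoid_def structure_hom_def compose_def)
  next
    fix f n xs
    assume f: "fun_arity S f = Some n" "length xs = n" "set xs \<subseteq> universe A"
    then have "compose (universe A) g h (fun_interp A f xs) = g (h (fun_interp A f xs))"
      using fun_in by (simp add: compose_def)
    also have "\<dots> = fun_interp A f (map g (map h xs))"
      using g h f map_in[OF f(3)] by (simp add: End_monoid_def structure_hom_def del: map_map)
    finally show "compose (universe A) g h (fun_interp A f xs) =
        fun_interp A f (map (compose (universe A) g h) xs)"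
      unfolding map_compose[OF f(3)] .
  next
    fix r n xs
    assume r: "rel_arity S r = Some n" "length xs = n" "set xs \<subseteq> universe A"
      "xs \<in> rel_interp A r"
    then have "map h xs \<in> rel_interp A r"
      using h by (simp add: End_monoid_def structure_hom_def)
    then have "map g (map h xs) \<in> rel_interp A r"
      using g r(1,2) map_in[OF r(3)] by (simp add: End_monoid_def structure_hom_def del: map_map)
    then show "map (compose (universe A) g h) xs \<in> rel_interp A r"
      unfolding map_compose[OF r(3)] .
  qed
  then show "g \<otimes>\<^bsub>End_monoid S A\<^esub> h \<in> carrier (End_monoid S A)"
    by (simp add: End_monoid_def)
next
  fix f g h
  assume "f \<in> carrier (End_monoid S A)" "g \<in> carrier (End_monoid S A)"
    "h \<in> carrier (End_monoid S A)"
  then have "h \<in> universe A \<rightarrow> universe A"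
    by (simp add: End_monoid_def structure_hom_def)
  then show "f \<otimes>\<^bsub>End_monoid S A\<^esub> g \<otimes>\<^bsub>End_monoid S A\<^esub> h =
      f \<otimes>\<^bsub>End_monoid S A\<^esub> (g \<otimes>\<^bsub>End_monoid S A\<^esub> h)"
    by (simp add: End_monoid_def compose_assoc)
next
  fix h
  assume "h \<in> carrier (End_monoid S A)"
  then have h: "h \<in> universe A \<rightarrow> universe A" "h \<in> extensional (universe A)"
    by (simp_all add: End_monoid_def structure_hom_def)
  show "\<one>\<^bsub>End_monoid S A\<^esub> \<otimes>\<^bsub>End_monoid S A\<^esub> h = h"
    using h by (simp add: End_monoid_def Id_compose)
  show "h \<otimes>\<^bsub>End_monoid S A\<^esub> \<one>\<^bsub>End_monoid S A\<^esub> = h"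
    using h by (simp add: End_monoid_def compose_Id)
qed

end

theory Submission
  imports Defs "HOL-Library.Nat_Bijection" "HOL-Library.Countable"
begin

text \<open>
  Let \<open>H\<close> be the generic hypergraph with hyperedges of all finite sizes, and call an injection
  \<open>n : H \<rightarrow> H\<close> a flip by \<open>c\<close> if it complements the hyperedges of the sizes in \<open>c\<close> and preserves
  the others. Take three disjoint copies of \<open>H\<close>, a source and two targets, and a further point.
  The monoids consist of the self-embeddings of \<open>H\<close> acting on all copies at once, of a zero, and of
  arrows: certain flips from the source to one of the targets, which send everything else to the
  further point, so that any two arrows compose to zero. Both monoids contain the self-embeddings as
  arrows to either target, and for every \<open>k\<close> the flips by \<open>{k + 1}\<close> as arrows to a single
  target. This target alternates with \<open>k\<close> in the first monoid and is constant in the second.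
  Algebraically the choice of the target is invisible. Topologically, flips by \<open>{k + 1}\<close> converge
  to the identity as \<open>k\<close> grows, so that in the second monoid the arrows to one of the targets
  that are self-embeddings form an open set, whereas in the first they do so for neither target.
  Both monoids are closed with oligomorphic unit groups, hence endomorphism monoids of
  \<open>\<omega>\<close>-categorical structures.
\<close>

section \<open>Back and forth\<close>

text \<open>Serves twice: with equality of types as \<open>P\<close> it yields isomorphisms between
  countable models, with partial flips as \<open>P\<close> it yields bijections of the hypergraph.
  Lists are used because types depend on the order of a tuple; \<open>zs0\<close> is the finite part
  to be extended.\<close>

lemma back_and_forth:
  fixes A :: "'a set" and B :: "'b set" and P :: "('a \<times> 'b) list \<Rightarrow> bool"
  assumes "countable A" "A \<noteq> {}" "countable B" "B \<noteq> {}"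
    and start: "P zs0" "set zs0 \<subseteq> A \<times> B"
    and forward: "\<And>zs a. P zs \<Longrightarrow> set zs \<subseteq> A \<times> B \<Longrightarrow> a \<in> A \<Longrightarrow> \<exists>b\<in>B. P (zs @ [(a, b)])"
    and backward: "\<And>zs b. P zs \<Longrightarrow> set zs \<subseteq> A \<times> B \<Longrightarrow> b \<in> B \<Longrightarrow> \<exists>a\<in>A. P (zs @ [(a, b)])"
  obtains z :: "nat \<Rightarrow> 'a \<times> 'b" where
    "range (fst \<circ> z) = A" "range (snd \<circ> z) = B"
    "map z [0..<length zs0] = zs0" "\<And>n. length zs0 \<le> n \<Longrightarrow> P (map z [0..<n])"
proof -
  \<comment> \<open>Stage \<open>2 * j\<close> puts the \<open>j\<close>-th element of
    \<open>A\<close> among the first coordinates, stage \<open>2 * j + 1\<close> the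
    \<open>j\<close>-th element of \<open>B\<close> among the second, which makes both projections
    surjective.\<close>
  define req where "req k x \<longleftrightarrow> (if even k then fst x = from_nat_into A (k div 2)
      else snd x = from_nat_into B (k div 2))" for k :: nat and x :: "'a \<times> 'b"
  define good where "good zs \<longleftrightarrow> P zs \<and> set zs \<subseteq> A \<times> B" for zs
  have step: "\<exists>x. good (zs @ [x]) \<and> req k x" if "good zs" for zs k
  proof (cases "even k")
    case True
    then show ?thesis
      using that forward[of zs "from_nat_into A (k div 2)"] from_nat_into[OF \<open>A \<noteq> {}\<close>]
      by (fastforce simp: req_def good_def)
  next
    case False
    then show ?thesis
      using that backward[of zs "from_nat_into B (k div 2)"] from_nat_into[OF \<open>B \<noteq> {}\<close>]
      by (fastforce simp: req_def good_def)
  qed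
  define next_pair where "next_pair zs k = (SOME x. good (zs @ [x]) \<and> req k x)" for zs k
  define e where "e = rec_nat zs0 (\<lambda>k zs. zs @ [next_pair zs k])"
  have e0: "e 0 = zs0" and eS: "e (Suc k) = e k @ [next_pair (e k) k]" for k
    by (simp_all add: e_def)
  have good: "good (e k)" for k
  proof (induction k)
    case (Suc k)
    then show ?case
      using someI_ex[OF step[OF Suc, of k]] by (simp add: eS next_pair_def)
  qed (simp add: e0 good_def start)
  have req: "req k (next_pair (e k) k)" for k
    using someI_ex[OF step[OF good[of k], of k]] by (simp add: next_pair_def)
  have len: "length (e k) = length zs0 + k" for k
    by (induction k) (simp_all add: e0 eS)
  have stable: "i < length (e k) \<Longrightarrow> e (k + j) ! i = e k ! i" for i k j
    by (induction j) (simp_all add: eS nth_append len)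
  \<comment> \<open>The lists \<open>e k\<close> only grow, and \<open>e (Suc i)\<close> is always
    long enough to have an entry \<open>i\<close>, so this is the entry in the limit.\<close>
  define z where "z i = e (Suc i) ! i" for i
  have z: "z i = e k ! i" if "i < length (e k)" for i k
  proof (cases "Suc i \<le> k")
    case True
    then show ?thesis
      using stable[of i "Suc i" "k - Suc i"] by (simp add: z_def len)
  next
    case False
    then show ?thesis
      using stable[of i k "Suc i - k"] that by (simp add: z_def)
  qed
  have map_z: "map z [0..<length zs0 + k] = e k" for k
    by (rule nth_equalityI) (simp_all add: len z)
  have zk: "z (length zs0 + k) = next_pair (e k) k" for k
    using z[of "length zs0 + k" "Suc k"] by (simp add: len eS nth_append)
  have in_AB: "z i \<in> A \<times> B" for i
    using good[of "Suc i"] z[of i "Suc i"] nth_mem[of i "e (Suc i)"]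
    by (auto simp: good_def len)
  have "a \<in> range (fst \<circ> z)" if a: "a \<in> A" for a
  proof -
    obtain k where "a = from_nat_into A k"
      using from_nat_into_surj[OF \<open>countable A\<close> a] by metis
    then have "fst (z (length zs0 + 2 * k)) = a"
      using req[of "2 * k"] by (simp add: zk req_def)
    then show ?thesis by (metis comp_apply rangeI)
  qed
  moreover have "b \<in> range (snd \<circ> z)" if b: "b \<in> B" for b
  proof -
    obtain k where "b = from_nat_into B k"
      using from_nat_into_surj[OF \<open>countable B\<close> b] by metis
    then have "snd (z (length zs0 + Suc (2 * k))) = b"
      using req[of "Suc (2 * k)"] by (simp only: zk req_def) simp
    then show ?thesis by (metis comp_apply rangeI)
  qed
  moreover have "fst (z i) \<in> A" "snd (z i) \<in> B" for i
    using in_AB[of i] by (auto simp: mem_Times_iff)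
  ultimately have "range (fst \<circ> z) = A" "range (snd \<circ> z) = B"
    by auto
  moreover have "P (map z [0..<n])" if "length zs0 \<le> n" for n
    using good[of "n - length zs0"] map_z[of "n - length zs0"] that by (simp add: good_def)
  ultimately show ?thesis
    using that map_z[of 0] by (simp add: e0)
qed

section \<open>Finitely many types\<close>

lemma finite_vars_trm: "finite (vars_trm t)"
  by (induction t) auto

lemma finite_free_vars: "finite (free_vars p)"
  by (induction p) (auto simp: finite_vars_trm)

lemma free_vars_bound: obtains n where "free_vars p \<subseteq> {..<n}"
  using finite_free_vars[of p] finite_nat_iff_bounded by blast

lemma eval_trm_cong: "(\<And>x. x \<in> vars_trm t \<Longrightarrow> v x = w x) \<Longrightarrow> eval_trm A v t = eval_trm A w t"
proof (induction t)
  case (Fun f ts)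
  then have "map (eval_trm A v) ts = map (eval_trm A w) ts"
    by (intro map_cong) auto
  then show ?case by (metis eval_trm.simps(2))
qed simp

lemma satisfies_cong:
  "(\<And>x. x \<in> free_vars p \<Longrightarrow> v x = w x) \<Longrightarrow> satisfies A v p = satisfies A w p"
proof (induction p arbitrary: v w)
  case (Equal s t)
  then show ?case
    using eval_trm_cong[of s v w A] eval_trm_cong[of t v w A] by simp
next
  case (Rel r ts)
  then have "map (eval_trm A v) ts = map (eval_trm A w) ts"
    by (intro map_cong eval_trm_cong) auto
  then show ?case by (metis satisfies.simps(2))
next
  case (Conj p q)
  then show ?case by (metis UnCI free_vars.simps(4) satisfies.simps(4))
next
  case (Exist x p)
  have "satisfies A (v(x := a)) p = satisfies A (w(x := a)) p" for a
    using Exist.prems by (intro Exist.IH) auto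
  then show ?case by simp
next
  case (Neg p)
  have "satisfies A v p = satisfies A w p"
    using Neg.prems by (intro Neg.IH) simp
  then show ?case by simp
qed

section \<open>Universal closure: from open formulas to sentences\<close>

primrec forall_below :: "nat \<Rightarrow> ('f, 'r) fm \<Rightarrow> ('f, 'r) fm" where
  "forall_below 0 p = p"
| "forall_below (Suc n) p = forall_below n (Neg (Exist n (Neg p)))"

lemma wf_forall_below [simp]: "wf_fm S (forall_below n p) = wf_fm S p"
  by (induction n arbitrary: p) auto

lemma free_vars_forall_below: "free_vars (forall_below n p) = free_vars p - {..<n}"
  by (induction n arbitrary: p) (auto simp: less_Suc_eq)

lemma satisfies_forall_below:
  "satisfies A v (forall_below n p) \<longleftrightarrow>
    (\<forall>w. (\<forall>i<n. w i \<in> universe A) \<longrightarrow> (\<forall>i\<ge>n. w i = v i) \<longrightarrow> satisfies A w p)"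
proof (induction n arbitrary: p)
  case 0
  have "(\<forall>i\<ge>0. w i = v i) \<longleftrightarrow> w = v" for w by auto
  then show ?case by simp
next
  case (Suc n)
  have "(\<forall>w. (\<forall>i<n. w i \<in> universe A) \<longrightarrow> (\<forall>i\<ge>n. w i = v i) \<longrightarrow>
          (\<forall>a\<in>universe A. satisfies A (w(n := a)) p)) \<longleftrightarrow>
        (\<forall>w. (\<forall>i<Suc n. w i \<in> universe A) \<longrightarrow> (\<forall>i\<ge>Suc n. w i = v i) \<longrightarrow> satisfies A w p)"
    (is "?L \<longleftrightarrow> ?R")
  proof
    assume L: ?L
    show ?R
    proof (intro allI impI)
      fix w assume w: "\<forall>i<Suc n. w i \<in> universe A" "\<forall>i\<ge>Suc n. w i = v i"
      \<comment> \<open>The left-hand side speaks of valuations that agree with \<open>v\<close> at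
        \<open>n\<close> too, so \<open>w\<close> is reset there and the quantified element restores
        \<open>w n\<close>.\<close>
      have "satisfies A ((w(n := v n))(n := w n)) p"
        using w by (intro L[rule_format]) (auto simp: Suc_le_eq)
      then show "satisfies A w p" by simp
    qed
  qed auto
  then show ?case by (simp add: Suc)
qed

lemma holds_forall_below:
  assumes "universe A \<noteq> {}" "free_vars p \<subseteq> {..<n}"
  shows "holds A (forall_below n p) \<longleftrightarrow> holds A p"
proof
  assume "holds A (forall_below n p)"
  then show "holds A p"
    unfolding holds_def satisfies_forall_below by (metis range_subsetD)
next
  assume p: "holds A p"
  show "holds A (forall_below n p)"
    unfolding holds_def satisfies_forall_below
  proof (intro allI impI)
    fix v w :: "nat \<Rightarrow> _"
    assume "range v \<subseteq> universe A" "\<forall>i<n. w i \<in> universe A" "\<forall>i\<ge>n. w i = v i"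
    then have "range w \<subseteq> universe A"
      by (metis image_subsetI linorder_not_less range_subsetD)
    then show "satisfies A w p" using p by (simp add: holds_def)
  qed
qed

text \<open>A theory contains sentences only, so the validity of an open formula passes to the model
  through its universal closure.\<close>

lemma model_holds:
  assumes "universe A \<noteq> {}" "is_model S (theory_of S A) M" "wf_fm S p" "holds A p"
  shows "holds M p"
proof -
  obtain n where n: "free_vars p \<subseteq> {..<n}" by (rule free_vars_bound)
  have "forall_below n p \<in> theory_of S A"
    using n assms holds_forall_below[OF assms(1) n]
    by (auto simp: theory_of_def sentence_def free_vars_forall_below)
  then have "holds M (forall_below n p)" using assms by (simp add: is_model_def)
  moreover have "universe M \<noteq> {}" using assms by (simp add: is_model_def is_structure_def)
  ultimately show ?thesis by (simp add: holds_forall_below[OF _ n])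
qed

text \<open>The empty conjunction is closed, so that it also serves as a formula in no variables.\<close>

primrec conjs :: "('f, 'r) fm list \<Rightarrow> ('f, 'r) fm" where
  "conjs [] = Neg (Exist 0 (Neg (Equal (Var 0) (Var 0))))"
| "conjs (p # ps) = Conj p (conjs ps)"

lemma satisfies_conjs [simp]: "satisfies A v (conjs ps) \<longleftrightarrow> (\<forall>p\<in>set ps. satisfies A v p)"
  by (induction ps) auto

lemma wf_conjs [simp]: "wf_fm S (conjs ps) \<longleftrightarrow> (\<forall>p\<in>set ps. wf_fm S p)"
  by (induction ps) auto

lemma free_vars_conjs [simp]: "free_vars (conjs ps) = \<Union>(free_vars ` set ps)"
  by (induction ps) auto

section \<open>Complete types and isolating formulas\<close>

definition formulas :: "('f, 'r) signature \<Rightarrow> nat \<Rightarrow> ('f, 'r) fm set" where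
  "formulas S n = {p. wf_fm S p \<and> free_vars p \<subseteq> {..<n}}"

definition type_of ::
  "('f, 'r) signature \<Rightarrow> ('f, 'r, 'a) fo_structure \<Rightarrow> nat \<Rightarrow> (nat \<Rightarrow> 'a) \<Rightarrow> ('f, 'r) fm set" where
  "type_of S A n v = {p \<in> formulas S n. satisfies A v p}"

text \<open>The syntactic counterpart of oligomorphicity: for each \<open>n\<close>, finitely many
  complete \<open>n\<close>-types are realised in \<open>A\<close>.\<close>

definition finitely_many_types ::
  "('f, 'r) signature \<Rightarrow> ('f, 'r, 'a) fo_structure \<Rightarrow> bool" where
  "finitely_many_types S A \<longleftrightarrow>
    (\<forall>n. finite (type_of S A n ` {v. range v \<subseteq> universe A}))"

lemma type_of_cong: "(\<And>i. i < n \<Longrightarrow> v i = w i) \<Longrightarrow> type_of S A n v = type_of S A n w"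
  unfolding type_of_def formulas_def by (auto; metis satisfies_cong lessThan_iff subsetD)

text \<open>Complete types are closed under negation of the formulas they omit, so distinct ones are
  never nested. Hence each of the finitely many other types misses some formula of the type of
  \<open>v\<close>, and the conjunction of these formulas isolates it.\<close>

lemma isolating_formula:
  assumes fin: "finitely_many_types S A" and v: "range v \<subseteq> universe A"
  obtains p where "p \<in> formulas S n" "satisfies A v p"
    "\<And>w. range w \<subseteq> universe A \<Longrightarrow> satisfies A w p \<Longrightarrow> type_of S A n w = type_of S A n v"
proof -
  define T where "T = type_of S A n ` {v. range v \<subseteq> universe A} - {type_of S A n v}"
  have "\<exists>q. q \<in> type_of S A n v \<and> q \<notin> t" if t: "t \<in> T" for t
  proof (rule ccontr)
    assume "\<nexists>q. q \<in> type_of S A n v \<and> q \<notin> t"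
    then have sub: "type_of S A n v \<subseteq> t" by blast
    obtain w where w: "t = type_of S A n w" using t by (auto simp: T_def)
    have "t \<subseteq> type_of S A n v"
    proof (rule ccontr)
      assume "\<not> t \<subseteq> type_of S A n v"
      then obtain q where q: "q \<in> t" "q \<notin> type_of S A n v" by blast
      then have "Neg q \<in> type_of S A n v" "Neg q \<notin> t"
        by (auto simp: w type_of_def formulas_def)
      then show False using sub by blast
    qed
    then show False using sub t by (auto simp: T_def)
  qed
  then obtain q where q: "\<And>t. t \<in> T \<Longrightarrow> q t \<in> type_of S A n v \<and> q t \<notin> t" by metis
  have "finite T" using fin by (simp add: T_def finitely_many_types_def)
  then obtain ts where ts: "set ts = T" using finite_list by blast
  show ?thesis
  proof
    show "conjs (map q ts) \<in> formulas S n" "satisfies A v (conjs (map q ts))"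
      using q ts by (auto simp: type_of_def formulas_def)
    fix w assume w: "range w \<subseteq> universe A" "satisfies A w (conjs (map q ts))"
    show "type_of S A n w = type_of S A n v"
    proof (rule ccontr)
      assume "type_of S A n w \<noteq> type_of S A n v"
      then have t: "type_of S A n w \<in> T" using w by (auto simp: T_def)
      then have "q (type_of S A n w) \<in> type_of S A n w"
        using w ts q[OF t] by (simp add: type_of_def)
      then show False using q[OF t] by blast
    qed
  qed
qed

text \<open>\<open>A\<close> satisfies the finite disjunction of the isolating formulas of its
  types, hence so does \<open>M\<close>, and \<open>v\<close> satisfies one of them. That
  \<open>p\<close> decides every \<open>q\<close> is phrased as validity in \<open>A\<close>, a form
  that transfers to all models of the theory.\<close>

lemma model_realises_isolating_formula:
  assumes ne: "universe A \<noteq> {}" and fin: "finitely_many_types S A"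
    and M: "is_model S (theory_of S A) M" and v: "range v \<subseteq> universe M"
  obtains p where "p \<in> formulas S n" "satisfies M v p"
    "\<And>q. q \<in> formulas S n \<Longrightarrow> holds A (Neg (Conj p q)) \<or> holds A (Neg (Conj p (Neg q)))"
proof -
  define V where "V = {v :: nat \<Rightarrow> _. range v \<subseteq> universe A}"
  have "\<exists>p. p \<in> formulas S n \<and> satisfies A v p \<and>
      (\<forall>w\<in>V. satisfies A w p \<longrightarrow> type_of S A n w = type_of S A n v)" if v: "v \<in> V" for v
  proof -
    from v have "range v \<subseteq> universe A" by (simp add: V_def)
    from isolating_formula[OF fin this] show ?thesis by (simp add: V_def) blast
  qed
  then obtain iso where iso: "\<And>v. v \<in> V \<Longrightarrow> iso v \<in> formulas S n \<and> satisfies A v (iso v) \<and>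
      (\<forall>w\<in>V. satisfies A w (iso v) \<longrightarrow> type_of S A n w = type_of S A n v)"
    by metis
  have "finite (type_of S A n ` V)" using fin by (simp add: V_def finitely_many_types_def)
  then obtain R where R: "finite R" "R \<subseteq> V" "type_of S A n ` V = type_of S A n ` R"
    by (metis finite_subset_image order_refl)
  obtain rs where rs: "set rs = R" using R finite_list by blast
  \<comment> \<open>The disjunction of the isolating formulas, written by de Morgan with the
    available connectives.\<close>
  define d where "d = Neg (conjs (map (\<lambda>u. Neg (iso u)) rs))"
  have "holds A d"
    unfolding holds_def
  proof (intro allI impI)
    fix w :: "nat \<Rightarrow> _" assume "range w \<subseteq> universe A"
    then have w: "w \<in> V" by (simp add: V_def)
    then obtain u where u: "u \<in> R" "type_of S A n w = type_of S A n u" using R(3) by blast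
    then have "iso u \<in> type_of S A n u" using iso R(2) by (auto simp: type_of_def)
    then have "iso u \<in> type_of S A n w" using u by simp
    then have "satisfies A w (iso u)" by (simp add: type_of_def)
    then show "satisfies A w d" using u rs by (auto simp: d_def)
  qed
  moreover have "wf_fm S d" using iso R(2) rs by (auto simp: d_def formulas_def)
  ultimately have "satisfies M v d" using model_holds[OF ne M] v by (simp add: holds_def)
  then obtain u where u: "u \<in> V" "satisfies M v (iso u)"
    using rs R(2) by (auto simp: d_def)
  show ?thesis
  proof
    show "iso u \<in> formulas S n" "satisfies M v (iso u)" using u iso by auto
    fix q assume q: "q \<in> formulas S n"
    have eq: "satisfies A w q = satisfies A u q" if "w \<in> V" "satisfies A w (iso u)" for w
    proof -
      have "type_of S A n w = type_of S A n u" using iso u that by blast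
      then show ?thesis using q by (auto simp: type_of_def)
    qed
    show "holds A (Neg (Conj (iso u) q)) \<or> holds A (Neg (Conj (iso u) (Neg q)))"
      using eq by (cases "satisfies A u q") (auto simp: holds_def V_def)
  qed
qed

text \<open>If \<open>p\<close> isolates the type of the extended tuple, then
  \<open>Exist n p\<close> belongs to the type of the shorter one, so \<open>N\<close> supplies a
  witness \<open>b\<close>. As \<open>p\<close> decides every formula in the same way in both
  models, the extended types agree.\<close>

lemma type_extension:
  assumes ne: "universe A \<noteq> {}" and fin: "finitely_many_types S A"
    and M: "is_model S (theory_of S A) M" and N: "is_model S (theory_of S A) N"
    and v: "range v \<subseteq> universe M" and w: "range w \<subseteq> universe N"
    and type: "type_of S M n v = type_of S N n w" and a: "a \<in> universe M"
  obtains b where "b \<in> universe N"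
    "type_of S M (Suc n) (v(n := a)) = type_of S N (Suc n) (w(n := b))"
proof -
  let ?v = "v(n := a)"
  have v': "range ?v \<subseteq> universe M" using v a by auto
  obtain p where p: "p \<in> formulas S (Suc n)" "satisfies M ?v p" and
    decide: "\<And>q. q \<in> formulas S (Suc n) \<Longrightarrow>
      holds A (Neg (Conj p q)) \<or> holds A (Neg (Conj p (Neg q)))"
    using model_realises_isolating_formula[OF ne fin M v'] by metis
  have "Exist n p \<in> type_of S M n v"
    using p a by (auto simp: type_of_def formulas_def)
  then have "Exist n p \<in> type_of S N n w" by (simp add: type)
  then obtain b where b: "b \<in> universe N" "satisfies N (w(n := b)) p"
    by (auto simp: type_of_def)
  have w': "range (w(n := b)) \<subseteq> universe N" using w b by auto
  have "satisfies M ?v q = satisfies N (w(n := b)) q" if q: "q \<in> formulas S (Suc n)" for q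
  proof -
    have wf: "wf_fm S (Neg (Conj p q))" "wf_fm S (Neg (Conj p (Neg q)))"
      using p q by (auto simp: formulas_def)
    show ?thesis
      using decide[OF q]
    proof
      assume h: "holds A (Neg (Conj p q))"
      show ?thesis
        using model_holds[OF ne M wf(1) h] model_holds[OF ne N wf(1) h] v' w' p b
        by (simp add: holds_def)
    next
      assume h: "holds A (Neg (Conj p (Neg q)))"
      show ?thesis
        using model_holds[OF ne M wf(2) h] model_holds[OF ne N wf(2) h] v' w' p b
        by (simp add: holds_def)
    qed
  qed
  then show ?thesis using that b by (auto simp: type_of_def)
qed

text \<open>The isomorphism sends \<open>f i\<close> to \<open>g i\<close>. The enumerations may
  have repetitions: equations between variables make the map well defined and injective, and the
  other atomic formulas make it respect relations and functions.\<close>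

lemma structure_iso_of_enumerations:
  assumes M: "is_structure S M" and N: "is_structure S N"
    and f: "range f = universe M" and g: "range g = universe N"
    and eq: "\<And>p. wf_fm S p \<Longrightarrow> satisfies M f p = satisfies N g p"
  shows "\<exists>h. structure_iso S M N h"
proof -
  have inj: "f i = f j \<longleftrightarrow> g i = g j" for i j
    using eq[of "Equal (Var i) (Var j)"] by simp
  define h where "h x = g (SOME i. f i = x)" for x
  have h: "h (f i) = g i" for i
  proof -
    have "f (SOME j. f j = f i) = f i" by (rule someI) (rule refl)
    then show ?thesis using inj by (simp add: h_def)
  qed
  have indices: "\<exists>js. xs = map f js" if "set xs \<subseteq> universe M" for xs
  proof -
    have "\<forall>x\<in>set xs. \<exists>i. x = f i" using that f by blast
    then show ?thesis by (simp add: ex_map_conv)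
  qed
  have rel: "map h xs \<in> rel_interp N r \<longleftrightarrow> xs \<in> rel_interp M r"
    if r: "rel_arity S r = Some (length xs)" "set xs \<subseteq> universe M" for r xs
  proof -
    obtain js where xs: "xs = map f js" using indices r by blast
    have "wf_fm S (Rel r (map Var js))"
      using r xs by (simp add: list_all_iff)
    then show ?thesis
      using eq[of "Rel r (map Var js)"] by (simp add: xs o_def h)
  qed
  have fun_eq: "h (fun_interp M k xs) = fun_interp N k (map h xs)"
    if k: "fun_arity S k = Some (length xs)" "set xs \<subseteq> universe M" for k xs
  proof -
    obtain js where xs: "xs = map f js" using indices k by blast
    have "fun_interp M k xs \<in> range f" using M k f by (simp add: is_structure_def)
    then obtain j where j: "fun_interp M k xs = f j" by blast
    have "wf_fm S (Equal (Var j) (Fun k (map Var js)))"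
      using k xs by (simp add: list_all_iff)
    then show ?thesis
      using eq[of "Equal (Var j) (Fun k (map Var js))"] j by (simp add: xs o_def h)
  qed
  have "bij_betw h (universe M) (universe N)"
    unfolding bij_betw_def inj_on_def f[symmetric] g[symmetric]
    using inj by (auto simp: h image_iff)
  moreover have "h \<in> universe M \<rightarrow> universe N"
    using calculation by (auto simp: bij_betw_def)
  ultimately have "structure_iso S M N h"
    unfolding structure_iso_def structure_hom_def using rel fun_eq by auto
  then show ?thesis by blast
qed

text \<open>If there are finitely many types, they are all isolated, so the back-and-forth construction
  applies to any two countable models.\<close>

theorem omega_categorical_if_finitely_many_types:
  assumes A: "is_structure S A" "countable (universe A)" and fin: "finitely_many_types S A"
  shows "omega_categorical S A"
  unfolding omega_categorical_def
proof (intro conjI allI impI A)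
  fix M N :: "('a, 'b, nat) fo_structure"
  assume M: "is_model S (theory_of S A) M" and N: "is_model S (theory_of S A) N"
  have ne: "universe A \<noteq> {}" "universe M \<noteq> {}" "universe N \<noteq> {}"
    using A M N by (auto simp: is_model_def is_structure_def)
  then obtain m0 n0 where m0: "m0 \<in> universe M" and n0: "n0 \<in> universe N" by blast
  \<comment> \<open>Valuations are total, so a finite tuple is padded with a default element;
    formulas in the first \<open>length xs\<close> variables do not see the padding.\<close>
  define val :: "nat \<Rightarrow> nat list \<Rightarrow> nat \<Rightarrow> nat" where
    "val d xs i = (if i < length xs then xs ! i else d)" for d xs i
  have val_range: "range (val d xs) \<subseteq> U" if "d \<in> U" "set xs \<subseteq> U" for d xs and U :: "nat set"
    using that by (auto simp: val_def)
  have val_append: "(val d xs)(length xs := x) = val d (xs @ [x])" for d xs x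
    by (auto simp: val_def fun_eq_iff nth_append)
  define P where "P zs \<longleftrightarrow> type_of S M (length zs) (val m0 (map fst zs)) =
    type_of S N (length zs) (val n0 (map snd zs))" for zs
  \<comment> \<open>Completeness of the theory: a formula without free variables or its negation
    holds in \<open>A\<close>, hence in both models. This starts the construction at the empty
    list.\<close>
  have decided: "satisfies M v p = satisfies N w p"
    if "p \<in> formulas S 0" "range v \<subseteq> universe M" "range w \<subseteq> universe N" for p v w
  proof -
    have p: "wf_fm S p" "wf_fm S (Neg p)" "free_vars p = {}" using that by (auto simp: formulas_def)
    have "satisfies A u p = satisfies A u' p" for u u'
      using p by (intro satisfies_cong) auto
    then have "holds A p \<or> holds A (Neg p)" by (auto simp: holds_def)
    then show ?thesis
    proof
      assume h: "holds A p"
      show ?thesis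
        using model_holds[OF ne(1) M p(1) h] model_holds[OF ne(1) N p(1) h] that
        by (simp add: holds_def)
    next
      assume h: "holds A (Neg p)"
      show ?thesis
        using model_holds[OF ne(1) M p(2) h] model_holds[OF ne(1) N p(2) h] that
        by (simp add: holds_def)
    qed
  qed
  obtain z :: "nat \<Rightarrow> nat \<times> nat" where z: "range (fst \<circ> z) = universe M"
    "range (snd \<circ> z) = universe N" "\<And>n. P (map z [0..<n])"
  proof (rule back_and_forth[of "universe M" "universe N" P "[]"])
    show "P []"
      using decided val_range[OF m0, of "[]"] val_range[OF n0, of "[]"]
      by (auto simp: P_def type_of_def)
  next
    fix zs a assume zs: "P zs" "set zs \<subseteq> universe M \<times> universe N" "a \<in> universe M"
    have s: "set (map fst zs) \<subseteq> universe M" "set (map snd zs) \<subseteq> universe N"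
      using zs by auto
    obtain b where "b \<in> universe N" "type_of S M (Suc (length zs)) ((val m0 (map fst zs))(length zs := a)) =
       type_of S N (Suc (length zs)) ((val n0 (map snd zs))(length zs := b))"
      using type_extension[OF ne(1) fin M N val_range[OF m0 s(1)] val_range[OF n0 s(2)]
        zs(1)[unfolded P_def] zs(3)] by metis
    then show "\<exists>b\<in>universe N. P (zs @ [(a, b)])"
      using val_append[of m0 "map fst zs" a] val_append[of n0 "map snd zs" b]
      by (intro bexI[of _ b]) (simp_all add: P_def)
  next
    fix zs b assume zs: "P zs" "set zs \<subseteq> universe M \<times> universe N" "b \<in> universe N"
    have s: "set (map fst zs) \<subseteq> universe M" "set (map snd zs) \<subseteq> universe N"
      using zs by auto
    obtain a where "a \<in> universe M" "type_of S N (Suc (length zs)) ((val n0 (map snd zs))(length zs := b)) =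
       type_of S M (Suc (length zs)) ((val m0 (map fst zs))(length zs := a))"
      using type_extension[OF ne(1) fin N M val_range[OF n0 s(2)] val_range[OF m0 s(1)]
        zs(1)[unfolded P_def, symmetric] zs(3)] by metis
    then show "\<exists>a\<in>universe M. P (zs @ [(a, b)])"
      using val_append[of m0 "map fst zs" a] val_append[of n0 "map snd zs" b]
      by (intro bexI[of _ a]) (simp_all add: P_def)
  qed (use ne in auto)
  show "\<exists>h. structure_iso S M N h"
  proof (rule structure_iso_of_enumerations)
    show "is_structure S M" "is_structure S N" using M N by (simp_all add: is_model_def)
    show "range (fst \<circ> z) = universe M" "range (snd \<circ> z) = universe N" by (fact z)+
    fix p assume wf: "wf_fm S p"
    obtain n where n: "free_vars p \<subseteq> {..<n}" by (rule free_vars_bound)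
    have "type_of S M n (fst \<circ> z) = type_of S M n (val m0 (map fst (map z [0..<n])))"
      "type_of S N n (snd \<circ> z) = type_of S N n (val n0 (map snd (map z [0..<n])))"
      by (rule type_of_cong; simp add: val_def)+
    then have "type_of S M n (fst \<circ> z) = type_of S N n (snd \<circ> z)"
      using z(3)[of n] by (simp add: P_def)
    then show "satisfies M (fst \<circ> z) p = satisfies N (snd \<circ> z) p"
      using wf n by (auto simp: type_of_def formulas_def)
  qed
qed

section \<open>The generic hypergraph\<close>

text \<open>The analogue of the Rado graph with hyperedges of all finite sizes: the binary digits of the
  largest element of a finite set decide whether the set is a hyperedge.\<close>

definition edge :: "nat set \<Rightarrow> bool" where
  "edge S \<longleftrightarrow> set_encode (S - {Max S}) \<in> set_decode (Max S)"

text \<open>The extension property of the hypergraph. The binary digits of \<open>b\<close> are the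
  codes of the sets prescribed by \<open>F\<close>, together with a digit \<open>m\<close> larger
  than all elements of \<open>D\<close> and all codes of its subsets. This digit makes
  \<open>b\<close> exceed \<open>D\<close>, so that \<open>b\<close> is the maximum of
  \<open>insert b T\<close>, and it is not itself such a code.\<close>

lemma edge_extension:
  assumes D: "finite D"
  obtains b where "b \<notin> D" "\<And>T. T \<subseteq> D \<Longrightarrow> edge (insert b T) \<longleftrightarrow> T \<in> F"
proof -
  define m where "m = Suc (Max (D \<union> set_encode ` Pow D))"
  have m: "i < m" if "i \<in> D \<union> set_encode ` Pow D" for i
    using that D by (simp add: m_def less_Suc_eq_le)
  define E where "E = insert m (set_encode ` (F \<inter> Pow D))"
  define b where "b = set_encode E"
  have fin: "finite E" using D by (simp add: E_def)
  have "m < 2 ^ m" by (rule less_exp)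
  also have "2 ^ m \<le> b"
    unfolding b_def set_encode_def using fin by (intro member_le_sum) (auto simp: E_def)
  finally have b: "i < b" if "i \<in> D" for i
    using that m[of i] by simp
  show ?thesis
  proof
    show "b \<notin> D" using b by blast
    fix T assume T: "T \<subseteq> D"
    then have finT: "finite T" using D finite_subset by blast
    have Max: "Max (insert b T) = b"
      using b T finT by (intro Max_eqI) (auto intro: less_imp_le)
    have "insert b T - {b} = T" using b T by blast
    then have "edge (insert b T) \<longleftrightarrow> set_encode T \<in> E"
      unfolding edge_def Max by (simp add: b_def set_encode_inverse[OF fin])
    also have "\<dots> \<longleftrightarrow> set_encode T \<in> set_encode ` (F \<inter> Pow D)"
      using m[of "set_encode T"] T by (auto simp: E_def)
    also have "\<dots> \<longleftrightarrow> T \<in> F"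
    proof
      assume "set_encode T \<in> set_encode ` (F \<inter> Pow D)"
      then obtain T' where T': "set_encode T = set_encode T'" "T' \<in> F" "T' \<subseteq> D" by blast
      then have "T = T'"
        using finT D by (metis finite_subset set_encode_inverse)
      then show "T \<in> F" using T' by simp
    qed (use T in auto)
    finally show "edge (insert b T) \<longleftrightarrow> T \<in> F" .
  qed
qed

text \<open>\<open>flips {}\<close> is the monoid of self-embeddings. The empty set is its own
  image, so size 0 can never be complemented; hence the restriction to nonempty sets.\<close>

definition flips :: "nat set \<Rightarrow> (nat \<Rightarrow> nat) set" where
  "flips c = {f. inj f \<and>
    (\<forall>S. finite S \<longrightarrow> S \<noteq> {} \<longrightarrow> (edge (f ` S) \<longleftrightarrow> edge S \<noteq> (card S \<in> c)))}"

section \<open>Finite partial flips and their extension to bijections\<close>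

definition partial_flip :: "nat set \<Rightarrow> (nat \<times> nat) set \<Rightarrow> bool" where
  "partial_flip c p \<longleftrightarrow> (\<forall>x\<in>p. \<forall>y\<in>p. fst x = fst y \<longleftrightarrow> snd x = snd y) \<and>
    (\<forall>s\<subseteq>p. finite s \<longrightarrow> s \<noteq> {} \<longrightarrow> (edge (snd ` s) \<longleftrightarrow> edge (fst ` s) \<noteq> (card s \<in> c)))"

lemma partial_flip_subset: "partial_flip c p \<Longrightarrow> q \<subseteq> p \<Longrightarrow> partial_flip c q"
  unfolding partial_flip_def by (meson order_trans subsetD)

text \<open>Complementing the same sizes twice changes nothing, so the inverse of a partial flip is
  a partial flip by the same \<open>c\<close>. This reduces the back step to the forth step.\<close>

lemma partial_flip_swap: "partial_flip c (prod.swap ` p) \<longleftrightarrow> partial_flip c p"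
proof -
  have "partial_flip c (prod.swap ` p)" if p: "partial_flip c p" for p :: "(nat \<times> nat) set"
    unfolding partial_flip_def
  proof (intro conjI allI impI)
    show "\<forall>x\<in>prod.swap ` p. \<forall>y\<in>prod.swap ` p. (fst x = fst y) = (snd x = snd y)"
      using p unfolding partial_flip_def by auto
    fix s assume s: "s \<subseteq> prod.swap ` p" "finite s" "s \<noteq> {}"
    then have sw: "prod.swap ` s \<subseteq> p" by auto
    have "card (prod.swap ` s) = card s" by (intro card_image) auto
    moreover have "fst ` prod.swap ` s = snd ` s" "snd ` prod.swap ` s = fst ` s"
      by (simp_all add: image_comp)
    ultimately show "edge (snd ` s) \<longleftrightarrow> edge (fst ` s) \<noteq> (card s \<in> c)"
      using p s sw unfolding partial_flip_def by (metis finite_imageI image_is_empty)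
  qed
  from this[of p] this[of "prod.swap ` p"] show ?thesis
    by (auto simp: image_comp)
qed

lemma partial_flip_forth:
  assumes p: "partial_flip c p" "finite p"
  obtains b where "partial_flip c (insert (a, b) p)"
proof (cases "a \<in> fst ` p")
  case True
  then obtain b where "(a, b) \<in> p" by auto
  then show ?thesis using that[of b] p by (simp add: insert_absorb)
next
  case a: False
  \<comment> \<open>The requirement on the new value \<open>b\<close>: with a set \<open>T\<close>
    of old values it must form an edge exactly when \<open>a\<close> with the preimage of
    \<open>T\<close> does, up to complementation. The \<open>Suc\<close> counts the new
    point.\<close>
  define F where "F = {T. edge (insert a (fst ` {z \<in> p. snd z \<in> T})) \<noteq> (Suc (card T) \<in> c)}"
  obtain b where b: "b \<notin> snd ` p" "\<And>T. T \<subseteq> snd ` p \<Longrightarrow> edge (insert b T) \<longleftrightarrow> T \<in> F"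
    using edge_extension[of "snd ` p" F] p by blast
  have eq: "\<forall>x\<in>p. \<forall>y\<in>p. fst x = fst y \<longleftrightarrow> snd x = snd y"
    using p by (simp add: partial_flip_def)
  have "partial_flip c (insert (a, b) p)"
    unfolding partial_flip_def
  proof (intro conjI allI impI)
    show "\<forall>x\<in>insert (a, b) p. \<forall>y\<in>insert (a, b) p. (fst x = fst y) = (snd x = snd y)"
      using eq a b(1) by force
    fix s assume s: "s \<subseteq> insert (a, b) p" "finite s" "s \<noteq> {}"
    show "edge (snd ` s) \<longleftrightarrow> edge (fst ` s) \<noteq> (card s \<in> c)"
    proof (cases "(a, b) \<in> s")
      case False
      then have "s \<subseteq> p" using s by blast
      then show ?thesis using p s unfolding partial_flip_def by blast
    next
      case True
      define t where "t = s - {(a, b)}"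
      have t: "t \<subseteq> p" "s = insert (a, b) t" "(a, b) \<notin> t" "finite t"
        using s True by (auto simp: t_def)
      have T: "{z \<in> p. snd z \<in> snd ` t} = t"
      proof
        show "{z \<in> p. snd z \<in> snd ` t} \<subseteq> t"
          using eq t(1) by (auto simp: prod_eq_iff) (metis prod.collapse subsetD fst_conv snd_conv)
      qed (use t in auto)
      have "inj_on snd t" using eq t(1) by (auto simp: inj_on_def prod_eq_iff)
      then have "card s = Suc (card (snd ` t))"
        using t by (simp add: card_image)
      then show ?thesis
        using b(2)[of "snd ` t"] t T by (auto simp: F_def image_mono)
    qed
  qed
  then show ?thesis using that by blast
qed

lemma partial_flip_back:
  assumes p: "partial_flip c p" "finite p"
  obtains a where "partial_flip c (insert (a, b) p)"
proof -
  have "partial_flip c (prod.swap ` p)" "finite (prod.swap ` p)"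
    using p by (simp_all add: partial_flip_swap)
  then obtain a where "partial_flip c (insert (b, a) (prod.swap ` p))"
    by (rule partial_flip_forth)
  then have "partial_flip c (prod.swap ` insert (a, b) p)" by simp
  then show ?thesis using that partial_flip_swap by blast
qed

text \<open>For \<open>c = {}\<close> this is homogeneity of the hypergraph; for other
  \<open>c\<close> it also shows that bijective flips exist, since the empty set of pairs is a
  partial flip.\<close>

lemma partial_flip_extends:
  assumes p: "partial_flip c p" "finite p"
  obtains f where "bij f" "f \<in> flips c" "\<And>x. x \<in> p \<Longrightarrow> f (fst x) = snd x"
proof -
  obtain zs where zs: "set zs = p" using p finite_list by blast
  obtain z :: "nat \<Rightarrow> nat \<times> nat" where z: "range (fst \<circ> z) = UNIV" "range (snd \<circ> z) = UNIV"
    "map z [0..<length zs] = zs" "\<And>n. length zs \<le> n \<Longrightarrow> partial_flip c (set (map z [0..<n]))"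
  proof (rule back_and_forth[of UNIV UNIV "\<lambda>zs. partial_flip c (set zs)" zs])
    fix ys a assume "partial_flip c (set ys)"
    then obtain b where "partial_flip c (insert (a, b) (set ys))"
      using partial_flip_forth by blast
    then show "\<exists>b\<in>UNIV. partial_flip c (set (ys @ [(a, b)]))" by auto
  next
    fix ys b assume "partial_flip c (set ys)"
    then obtain a where "partial_flip c (insert (a, b) (set ys))"
      using partial_flip_back by blast
    then show "\<exists>a\<in>UNIV. partial_flip c (set (ys @ [(a, b)]))" by auto
  qed (use p zs in auto)
  \<comment> \<open>The condition on a flip concerns finite sets, and each of them lies in an
    initial part of \<open>z\<close>; the \<open>max\<close> is there because the invariant starts
    at \<open>length zs\<close>.\<close>
  have flip: "partial_flip c s" if s: "s \<subseteq> range z" "finite s" for s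
  proof -
    obtain I where I: "finite I" "s = z ` I" using s by (meson finite_subset_image)
    then obtain n where n: "I \<subseteq> {..<n}" using finite_nat_iff_bounded by blast
    have "s \<subseteq> set (map z [0..<max n (length zs)])" using I n by fastforce
    then show ?thesis using partial_flip_subset[OF z(4)[of "max n (length zs)"]] by simp
  qed
  have eq: "fst x = fst y \<longleftrightarrow> snd x = snd y" if "x \<in> range z" "y \<in> range z" for x y
    using flip[of "{x, y}"] that by (simp add: partial_flip_def)
  define f where "f a = snd (z (SOME i. fst (z i) = a))" for a
  have fz: "f (fst (z i)) = snd (z i)" for i
  proof -
    have "fst (z (SOME j. fst (z j) = fst (z i))) = fst (z i)" by (rule someI) (rule refl)
    then show ?thesis using eq by (simp add: f_def)
  qed
  have surj1: "\<exists>i. a = fst (z i)" and surj2: "\<exists>i. a = snd (z i)" for a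
    using z(1,2) by (metis UNIV_I comp_apply image_iff)+
  have "inj f" by (rule injI) (metis fz surj1 eq rangeI)
  moreover have "surj f" unfolding surj_def by (metis fz surj2)
  moreover have "f \<in> flips c"
    unfolding flips_def
  proof (intro CollectI conjI allI impI \<open>inj f\<close>)
    fix S :: "nat set" assume S: "finite S" "S \<noteq> {}"
    define s where "s = (\<lambda>a. (a, f a)) ` S"
    have "(a, f a) \<in> range z" for a
      using surj1[of a] fz by (metis prod.collapse rangeI)
    then have "partial_flip c s" using S by (intro flip) (auto simp: s_def)
    moreover have "card s = card S" unfolding s_def by (intro card_image) (auto simp: inj_on_def)
    moreover have "fst ` s = S" "snd ` s = f ` S" by (simp_all add: s_def image_image)
    moreover have "finite s" "s \<noteq> {}" using S by (simp_all add: s_def)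
    ultimately show "edge (f ` S) \<longleftrightarrow> edge S \<noteq> (card S \<in> c)"
      unfolding partial_flip_def by (metis order_refl)
  qed
  moreover have "f (fst x) = snd x" if "x \<in> p" for x
  proof -
    have "x \<in> set (map z [0..<length zs])" using that zs z(3) by simp
    then show ?thesis using fz by auto
  qed
  ultimately show ?thesis using that by (simp add: bij_def)
qed

lemma edge_image_flip:
  "f \<in> flips c \<Longrightarrow> finite S \<Longrightarrow> S \<noteq> {} \<Longrightarrow> edge (f ` S) \<longleftrightarrow> edge S \<noteq> (card S \<in> c)"
  by (simp add: flips_def)

lemma id_in_flips: "id \<in> flips {}"
  by (simp add: flips_def)

lemma comp_flips:
  assumes "f \<in> flips c" "g \<in> flips d"
  shows "f \<circ> g \<in> flips ((c - d) \<union> (d - c))"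
  unfolding flips_def
proof (intro CollectI conjI allI impI)
  show "inj (f \<circ> g)" using assms by (simp add: flips_def inj_compose)
  fix S :: "nat set" assume S: "finite S" "S \<noteq> {}"
  have "inj g" using assms by (simp add: flips_def)
  then have "card (g ` S) = card S" by (intro card_image) (rule inj_on_subset, auto)
  moreover have "edge (g ` S) \<longleftrightarrow> edge S \<noteq> (card S \<in> d)"
    using assms S by (simp add: flips_def)
  moreover have "edge (f ` g ` S) \<longleftrightarrow> edge (g ` S) \<noteq> (card (g ` S) \<in> c)"
    using assms(1) S by (simp add: flips_def)
  ultimately show "edge ((f \<circ> g) ` S) \<longleftrightarrow> edge S \<noteq> (card S \<in> (c - d) \<union> (d - c))"
    unfolding image_comp[symmetric] by auto
qed

lemma comp_flips_left: "f \<in> flips {} \<Longrightarrow> g \<in> flips c \<Longrightarrow> f \<circ> g \<in> flips c"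
  and comp_flips_right: "g \<in> flips c \<Longrightarrow> f \<in> flips {} \<Longrightarrow> g \<circ> f \<in> flips c"
  using comp_flips[of f "{}" g c] comp_flips[of g c f "{}"] by simp_all

text \<open>A set of size \<open>k > 0\<close> tests whether \<open>k\<close> is in
  \<open>c\<close>. No set tests size 0, which explains the hypotheses on 0.\<close>

lemma flips_eq:
  assumes "f \<in> flips c" "f \<in> flips d" "0 \<notin> c" "0 \<notin> d"
  shows "c = d"
proof -
  have "k \<in> c \<longleftrightarrow> k \<in> d" if "k \<noteq> 0" for k
    using edge_image_flip[OF assms(1), of "{..<k}"] edge_image_flip[OF assms(2), of "{..<k}"] that
    by auto
  then show ?thesis using assms(3,4) by (metis subsetI subset_antisym)
qed

lemma inv_in_flips:
  assumes "bij f" "f \<in> flips {}"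
  shows "inv_into UNIV f \<in> flips {}"
  unfolding flips_def
proof (intro CollectI conjI allI impI)
  show "inj (inv_into UNIV f)" using assms by (simp add: bij_imp_bij_inv bij_is_inj)
  fix S :: "nat set" assume S: "finite S" "S \<noteq> {}"
  have "f ` inv_into UNIV f ` S = S" using assms by (simp add: bij_is_surj image_f_inv_f)
  then show "edge (inv_into UNIV f ` S) \<longleftrightarrow> edge S \<noteq> (card S \<in> {})"
    using edge_image_flip[OF assms(2), of "inv_into UNIV f ` S"] S by simp
qed

text \<open>The identity on \<open>k\<close> points is a partial flip by \<open>{Suc k}\<close>,
  since no set of that size lies in its domain; it extends by back and forth.\<close>

lemma flip_near_identity:
  obtains f where "f \<in> flips {Suc k}" "\<And>q. q < k \<Longrightarrow> f q = q"
proof -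
  define p where "p = (\<lambda>q. (q, q)) ` {..<k}"
  have "partial_flip {Suc k} p"
    unfolding partial_flip_def
  proof (intro conjI allI impI)
    show "\<forall>x\<in>p. \<forall>y\<in>p. (fst x = fst y) = (snd x = snd y)" by (auto simp: p_def)
    fix s assume s: "s \<subseteq> p" "finite s" "s \<noteq> {}"
    have "card s \<le> card p" using s by (intro card_mono) (simp_all add: p_def)
    also have "card p \<le> k" using card_image_le[of "{..<k}"] by (simp add: p_def)
    finally have "card s \<notin> {Suc k}" by simp
    moreover have "fst ` s = snd ` s" using s(1) by (force simp: p_def)
    ultimately show "edge (snd ` s) \<longleftrightarrow> edge (fst ` s) \<noteq> (card s \<in> {Suc k})" by simp
  qed
  moreover have "finite p" by (simp add: p_def)
  ultimately obtain f where "f \<in> flips {Suc k}" "\<And>x. x \<in> p \<Longrightarrow> f (fst x) = snd x"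
    using partial_flip_extends by blast
  then show ?thesis using that by (force simp: p_def)
qed

text \<open>By the extension property some \<open>b\<close> outside \<open>{q, r}\<close> has the
  same edges over \<open>q\<close> as \<open>r\<close>, so fixing \<open>q\<close> and sending
  \<open>r\<close> to \<open>b\<close> is a partial embedding.\<close>

lemma embedding_separating:
  assumes "q \<noteq> r"
  obtains e where "e \<in> flips {}" "e q = q" "e r \<noteq> r"
proof -
  define F where "F = {T. edge (insert r (T - {r}))}"
  obtain b where b: "b \<notin> {q, r}" "\<And>T. T \<subseteq> {q, r} \<Longrightarrow> edge (insert b T) \<longleftrightarrow> T \<in> F"
    using edge_extension[of "{q, r}" F] by blast
  define p where "p = {(q, q), (r, b)}"
  have "partial_flip {} p"
    unfolding partial_flip_def
  proof (intro conjI allI impI)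
    show "\<forall>x\<in>p. \<forall>y\<in>p. (fst x = fst y) = (snd x = snd y)" using b(1) assms by (auto simp: p_def)
    fix s assume s: "s \<subseteq> p" "finite s" "s \<noteq> {}"
    then have "s \<in> Pow {(q, q), (r, b)} - {{}}" by (simp add: p_def)
    then consider "s = {(q, q)}" | "s = {(r, b)}" | "s = {(q, q), (r, b)}"
      unfolding Pow_insert Pow_empty by blast
    then show "edge (snd ` s) \<longleftrightarrow> edge (fst ` s) \<noteq> (card s \<in> {})"
      using b(2)[of "{}"] b(2)[of "{q}"] assms
      by cases (simp_all add: F_def insert_commute)
  qed
  moreover have "finite p" by (simp add: p_def)
  ultimately obtain e where "e \<in> flips {}" "\<And>x. x \<in> p \<Longrightarrow> e (fst x) = snd x"
    using partial_flip_extends by blast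
  then show ?thesis using that b(1) by (force simp: p_def)
qed

text \<open>If \<open>n\<close> commutes with an embedding fixing \<open>q\<close>, that embedding
  also fixes \<open>n q\<close>; separation then forces \<open>n q = q\<close>. This will identify
  \<open>arrow i id\<close> by algebraic means.\<close>

lemma commuting_eq_id:
  assumes "\<And>e. e \<in> flips {} \<Longrightarrow> n \<circ> e = e \<circ> n"
  shows "n = id"
proof (rule ccontr)
  assume "n \<noteq> id"
  then obtain q where "n q \<noteq> q" by (auto simp: fun_eq_iff)
  then have "q \<noteq> n q" by (rule not_sym)
  then obtain e where e: "e \<in> flips {}" "e q = q" "e (n q) \<noteq> n q"
    by (rule embedding_separating)
  then show False using fun_cong[OF assms[OF e(1)], of q] by simp
qed

section \<open>Closed monoids as endomorphism monoids\<close>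

lemma finite_image_coarser:
  assumes "finite (f ` X)" "\<And>x y. x \<in> X \<Longrightarrow> y \<in> X \<Longrightarrow> f x = f y \<Longrightarrow> g x = g y"
  shows "finite (g ` X)"
proof -
  obtain V where V: "finite V" "V \<subseteq> X" "f ` X = f ` V"
    using assms(1) by (metis finite_subset_image order_refl)
  have "g x \<in> g ` V" if x: "x \<in> X" for x
  proof -
    have "f x \<in> f ` V" using V(3) x by blast
    then obtain v where "v \<in> V" "f x = f v" by blast
    then show ?thesis using assms(2)[OF x, of v] V(2) by auto
  qed
  then have "g ` X \<subseteq> g ` V" by blast
  then show ?thesis using V(1) finite_subset by blast
qed

definition transformation_monoid :: "('x \<Rightarrow> 'x) set \<Rightarrow> bool" where
  "transformation_monoid M \<longleftrightarrow> id \<in> M \<and> (\<forall>f\<in>M. \<forall>g\<in>M. f \<circ> g \<in> M)"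

lemma transformation_monoid_id: "transformation_monoid M \<Longrightarrow> id \<in> M"
  and transformation_monoid_comp:
    "transformation_monoid M \<Longrightarrow> f \<in> M \<Longrightarrow> g \<in> M \<Longrightarrow> f \<circ> g \<in> M"
  by (simp_all add: transformation_monoid_def)

text \<open>Closedness in the topology of pointwise convergence, unfolded to approximation on finite
  sets.\<close>

definition pointwise_closed :: "('x \<Rightarrow> 'y) set \<Rightarrow> bool" where
  "pointwise_closed M \<longleftrightarrow>
    (\<forall>h. (\<forall>F. finite F \<longrightarrow> (\<exists>m\<in>M. \<forall>x\<in>F. m x = h x)) \<longrightarrow> h \<in> M)"

lemma pointwise_closedD:
  "pointwise_closed M \<Longrightarrow> (\<And>F. finite F \<Longrightarrow> \<exists>m\<in>M. \<forall>x\<in>F. m x = h x) \<Longrightarrow> h \<in> M"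
  by (simp add: pointwise_closed_def)

definition unit_group :: "('x \<Rightarrow> 'x) set \<Rightarrow> ('x \<Rightarrow> 'x) set" where
  "unit_group M = {g \<in> M. \<exists>h\<in>M. g \<circ> h = id \<and> h \<circ> g = id}"

lemma unit_group_comp:
  assumes "transformation_monoid M" "f \<in> unit_group M" "g \<in> unit_group M"
  shows "f \<circ> g \<in> unit_group M"
proof -
  obtain f' g' where inverses: "f' \<in> M" "f \<circ> f' = id" "f' \<circ> f = id" "g' \<in> M" "g \<circ> g' = id" "g' \<circ> g = id"
    and "f \<in> M" "g \<in> M"
    using assms(2,3) by (auto simp: unit_group_def)
  moreover have "(f \<circ> g) \<circ> (g' \<circ> f') = id" "(g' \<circ> f') \<circ> (f \<circ> g) = id"
    using inverses by (metis comp_assoc id_comp)+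
  ultimately show ?thesis
    using transformation_monoid_comp[OF assms(1)] unfolding unit_group_def by blast
qed

definition oligomorphic :: "('x \<Rightarrow> 'x) set \<Rightarrow> bool" where
  "oligomorphic G \<longleftrightarrow> (\<forall>n. finite ((\<lambda>xs. (\<lambda>g. map g xs) ` G) ` {xs. length xs = n}))"

text \<open>The relation coded by a tuple is the orbit of that tuple, so that a map preserves all relations
  iff it agrees on every finite set with some element of the monoid.\<close>

definition orbit_signature :: "(nat, nat) signature" where
  "orbit_signature =
    \<lparr>fun_arity = (\<lambda>_. None), rel_arity = (\<lambda>r. Some (length (from_nat r :: nat list)))\<rparr>"

definition orbit_structure :: "(nat \<Rightarrow> nat) set \<Rightarrow> (nat, nat, nat) fo_structure" where
  "orbit_structure M =
    \<lparr>universe = UNIV, fun_interp = (\<lambda>_ _. 0), rel_interp = (\<lambda>r. (\<lambda>m. map m (from_nat r)) ` M)\<rparr>"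

lemma universe_orbit_structure [simp]: "universe (orbit_structure M) = UNIV"
  by (simp add: orbit_structure_def)

lemma is_structure_orbit_structure: "is_structure orbit_signature (orbit_structure M)"
  by (auto simp: is_structure_def orbit_signature_def orbit_structure_def)

lemma orbit_structure_hom:
  assumes M: "transformation_monoid M" "pointwise_closed M"
  shows "structure_hom orbit_signature (orbit_structure M) (orbit_structure M) h \<longleftrightarrow> h \<in> M"
proof
  assume h: "structure_hom orbit_signature (orbit_structure M) (orbit_structure M) h"
  have "\<exists>m\<in>M. \<forall>x\<in>F. m x = h x" if F: "finite F" for F
  proof -
    obtain xs where xs: "set xs = F" using finite_list[OF F] by blast
    have "map id xs \<in> (\<lambda>m. map m xs) ` M"
      using transformation_monoid_id[OF M(1)] by (rule imageI)
    then have "xs \<in> rel_interp (orbit_structure M) (to_nat xs)"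
      by (simp add: orbit_structure_def)
    then have "map h xs \<in> rel_interp (orbit_structure M) (to_nat xs)"
      using h by (simp add: structure_hom_def orbit_signature_def)
    then obtain m where "m \<in> M" "map h xs = map m xs"
      by (auto simp: orbit_structure_def)
    then show ?thesis using xs by auto
  qed
  then show "h \<in> M" using M(2) unfolding pointwise_closed_def by blast
next
  assume h: "h \<in> M"
  have "map h (map m xs) \<in> (\<lambda>m. map m xs) ` M" if "m \<in> M" for m xs
    using transformation_monoid_comp[OF M(1) h that] by (intro image_eqI[of _ _ "h \<circ> m"]) simp_all
  then show "structure_hom orbit_signature (orbit_structure M) (orbit_structure M) h"
    by (auto simp: structure_hom_def orbit_signature_def orbit_structure_def simp del: map_map)
qed

lemma carrier_End_orbit_structure:
  assumes "transformation_monoid M" "pointwise_closed M"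
  shows "carrier (End_monoid orbit_signature (orbit_structure M)) = M"
  by (simp add: End_monoid_def orbit_structure_hom[OF assms])

lemma mult_End_orbit_structure:
  "f \<otimes>\<^bsub>End_monoid orbit_signature (orbit_structure M)\<^esub> g = f \<circ> g"
  by (simp add: End_monoid_def compose_def fun_eq_iff)

text \<open>A unit and its inverse both lie in \<open>M\<close> and hence preserve every relation,
  so units are automorphisms and preserve all formulas.\<close>

lemma orbit_structure_satisfies_unit:
  assumes M: "transformation_monoid M" and g: "g \<in> unit_group M" and p: "wf_fm orbit_signature p"
  shows "satisfies (orbit_structure M) (g \<circ> v) p \<longleftrightarrow> satisfies (orbit_structure M) v p"
proof -
  let ?A = "orbit_structure M"
  obtain h where h: "h \<in> M" "g \<in> M" "g \<circ> h = id" "h \<circ> g = id"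
    using g by (auto simp: unit_group_def)
  have hg: "h (g x) = x" and gh: "g (h x) = x" for x
    using h(3,4) by (metis comp_apply id_apply)+
  have inj: "inj g" by (metis hg injI)
  \<comment> \<open>Without function symbols, every well-formed term is a variable.\<close>
  have trm: "eval_trm ?A (g \<circ> v) t = g (eval_trm ?A v t)" if "wf_trm orbit_signature t" for t v
    using that by (cases t) (simp_all add: orbit_signature_def)
  have rel: "map g xs \<in> (\<lambda>m. map m ys) ` M \<longleftrightarrow> xs \<in> (\<lambda>m. map m ys) ` M" for xs ys
  proof
    assume "map g xs \<in> (\<lambda>m. map m ys) ` M"
    then obtain m where m: "m \<in> M" "map g xs = map m ys" by blast
    have "xs = map h (map g xs)" by (simp add: o_def hg)
    then have "xs = map (h \<circ> m) ys" by (simp add: m)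
    then show "xs \<in> (\<lambda>m. map m ys) ` M"
      using transformation_monoid_comp[OF M h(1) m(1)] by (rule image_eqI)
  next
    assume "xs \<in> (\<lambda>m. map m ys) ` M"
    then obtain m where m: "m \<in> M" "xs = map m ys" by blast
    then have "map g xs = map (g \<circ> m) ys" by simp
    then show "map g xs \<in> (\<lambda>m. map m ys) ` M"
      using transformation_monoid_comp[OF M h(2) m(1)] by (rule image_eqI)
  qed
  show ?thesis
    using p
  proof (induction p arbitrary: v)
    case (Equal s t)
    then show ?case by (simp only: satisfies.simps wf_fm.simps trm inj_eq[OF inj] simp_thms)
  next
    case (Rel r ts)
    then have "map (eval_trm ?A (g \<circ> v)) ts = map g (map (eval_trm ?A v) ts)"
      by (simp add: list_all_iff trm)
    moreover have "map g xs \<in> rel_interp ?A r \<longleftrightarrow> xs \<in> rel_interp ?A r" for xs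
      using rel by (simp add: orbit_structure_def)
    ultimately show ?case by (simp only: satisfies.simps)
  next
    case (Exist x p)
    have "satisfies ?A ((g \<circ> v)(x := g a)) p = satisfies ?A (v(x := a)) p" for a
    proof -
      have "(g \<circ> v)(x := g a) = g \<circ> v(x := a)" by auto
      then show ?thesis using Exist by (simp only: wf_fm.simps)
    qed
    then have "(\<exists>a. satisfies ?A ((g \<circ> v)(x := a)) p) \<longleftrightarrow> (\<exists>a. satisfies ?A (v(x := a)) p)"
      by (metis gh)
    then show ?case by (simp only: satisfies.simps universe_orbit_structure bex_UNIV)
  qed (simp_all only: satisfies.simps wf_fm.simps)
qed

text \<open>Tuples in the same orbit of the unit group have the same type, so finitely many orbits
  leave finitely many types.\<close>

lemma omega_categorical_orbit_structure:
  assumes M: "transformation_monoid M" and olig: "oligomorphic (unit_group M)"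
  shows "omega_categorical orbit_signature (orbit_structure M)"
proof (rule omega_categorical_if_finitely_many_types)
  show "finitely_many_types orbit_signature (orbit_structure M)"
    unfolding finitely_many_types_def
  proof
    fix n
    let ?T = "type_of orbit_signature (orbit_structure M) n"
    define orbit where "orbit xs = (\<lambda>g. map g xs) ` unit_group M" for xs :: "nat list"
    have id: "id \<in> unit_group M"
      using M by (auto simp: unit_group_def transformation_monoid_def)
    have eq: "?T v = ?T w" if "orbit (map v [0..<n]) = orbit (map w [0..<n])" for v w
    proof -
      have "map id (map w [0..<n]) \<in> orbit (map w [0..<n])"
        unfolding orbit_def using id by (rule imageI)
      then have "map w [0..<n] \<in> orbit (map v [0..<n])" by (simp add: that)
      then obtain g where g: "g \<in> unit_group M" "map w [0..<n] = map g (map v [0..<n])"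
        by (auto simp: orbit_def)
      then have "?T w = ?T (g \<circ> v)" by (intro type_of_cong) auto
      also have "\<dots> = ?T v"
        using orbit_structure_satisfies_unit[OF M g(1)] by (auto simp: type_of_def formulas_def)
      finally show ?thesis by simp
    qed
    have "finite (orbit ` {xs. length xs = n})"
      using olig by (simp add: oligomorphic_def orbit_def)
    then have "finite ((\<lambda>v. orbit (map v [0..<n])) ` UNIV)"
      by (rule finite_subset[rotated]) auto
    then have "finite (range ?T)"
      by (rule finite_image_coarser) (rule eq)
    then show "finite (?T ` {v. range v \<subseteq> universe (orbit_structure M)})"
      by simp
  qed
qed (simp_all add: is_structure_orbit_structure)

section \<open>Transport of monoids along a bijection\<close>

lemma transformation_monoid_conj:
  assumes "bij b" "transformation_monoid M"
  shows "transformation_monoid ((\<lambda>m. b \<circ> m \<circ> inv_into UNIV b) ` M)"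
proof -
  have inv: "inv_into UNIV b (b x) = x" "b (inv_into UNIV b y) = y" for x y
    using assms(1) by (simp_all add: bij_is_inj bij_is_surj surj_f_inv_f)
  show ?thesis
    unfolding transformation_monoid_def
  proof (intro conjI ballI)
    have "id \<in> M" using assms(2) by (simp add: transformation_monoid_def)
    moreover have "b \<circ> id \<circ> inv_into UNIV b = id" by (simp add: fun_eq_iff inv)
    ultimately show "id \<in> (\<lambda>m. b \<circ> m \<circ> inv_into UNIV b) ` M" by (metis imageI)
    fix f g assume "f \<in> (\<lambda>m. b \<circ> m \<circ> inv_into UNIV b) ` M" "g \<in> (\<lambda>m. b \<circ> m \<circ> inv_into UNIV b) ` M"
    then obtain m n where mn: "m \<in> M" "n \<in> M" "f = b \<circ> m \<circ> inv_into UNIV b"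
      "g = b \<circ> n \<circ> inv_into UNIV b" by blast
    then have "f \<circ> g = b \<circ> (m \<circ> n) \<circ> inv_into UNIV b" by (simp add: fun_eq_iff inv)
    moreover have "m \<circ> n \<in> M" using mn assms(2) by (simp add: transformation_monoid_def)
    ultimately show "f \<circ> g \<in> (\<lambda>m. b \<circ> m \<circ> inv_into UNIV b) ` M" by blast
  qed
qed

lemma pointwise_closed_conj:
  assumes "bij b" "pointwise_closed M"
  shows "pointwise_closed ((\<lambda>m. b \<circ> m \<circ> inv_into UNIV b) ` M)"
  unfolding pointwise_closed_def
proof (intro allI impI)
  have inv: "inv_into UNIV b (b x) = x" "b (inv_into UNIV b y) = y" for x y
    using assms(1) by (simp_all add: bij_is_inj bij_is_surj surj_f_inv_f)
  fix h assume h: "\<forall>F. finite F \<longrightarrow> (\<exists>f\<in>(\<lambda>m. b \<circ> m \<circ> inv_into UNIV b) ` M. \<forall>x\<in>F. f x = h x)"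
  let ?h = "inv_into UNIV b \<circ> h \<circ> b"
  have "\<exists>m\<in>M. \<forall>x\<in>F. m x = ?h x" if F: "finite F" for F
  proof -
    obtain m where "m \<in> M" "\<forall>y\<in>b ` F. (b \<circ> m \<circ> inv_into UNIV b) y = h y"
      using h F by blast
    then have "\<forall>x\<in>F. m x = ?h x" by (metis comp_apply imageI inv(1))
    then show ?thesis using \<open>m \<in> M\<close> by blast
  qed
  then have "?h \<in> M" using assms(2) unfolding pointwise_closed_def by blast
  moreover have "h = b \<circ> ?h \<circ> inv_into UNIV b" by (simp add: fun_eq_iff inv)
  ultimately show "h \<in> (\<lambda>m. b \<circ> m \<circ> inv_into UNIV b) ` M" by blast
qed

lemma oligomorphic_conj:
  assumes b: "bij b" and olig: "oligomorphic (unit_group M)"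
  shows "oligomorphic (unit_group ((\<lambda>m. b \<circ> m \<circ> inv_into UNIV b) ` M))"
  unfolding oligomorphic_def
proof
  fix n
  let ?c = "\<lambda>m. b \<circ> m \<circ> inv_into UNIV b"
  have inv: "inv_into UNIV b (b x) = x" "b (inv_into UNIV b y) = y" for x y
    using b by (simp_all add: bij_is_inj bij_is_surj surj_f_inv_f)
  have "?c f \<circ> ?c g = id \<longleftrightarrow> f \<circ> g = id" for f g
    by (simp add: fun_eq_iff inv) (metis inv)
  then have units: "unit_group (?c ` M) = ?c ` unit_group M"
    by (auto simp: unit_group_def image_iff)
  define orb where "orb xs = (\<lambda>g. map g xs) ` unit_group M" for xs
  have orb: "(\<lambda>g. map g xs) ` unit_group (?c ` M) = map b ` orb (map (inv_into UNIV b) xs)" for xs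
    unfolding units orb_def image_image by (simp add: o_def)
  have "(\<lambda>xs. (\<lambda>g. map g xs) ` unit_group (?c ` M)) ` {xs. length xs = n} \<subseteq>
      image (map b) ` orb ` {xs. length xs = n}"
    unfolding orb by auto
  moreover have "finite (image (map b) ` orb ` {xs. length xs = n})"
    using olig unfolding oligomorphic_def orb_def by blast
  ultimately show "finite ((\<lambda>xs. (\<lambda>g. map g xs) ` unit_group (?c ` M)) ` {xs. length xs = n})"
    by (rule finite_subset)
qed

text \<open>Evaluation at \<open>x\<close> is continuous into a discrete space, so the
  \<open>g\<close> with \<open>h g x = h f x\<close> form a neighbourhood of \<open>f\<close>. It
  contains a basic open set around \<open>f\<close>, and \<open>F\<close> consists of the finitely
  many coordinates which that set restricts.\<close>

lemma continuous_End_pointwise: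
  assumes M: "transformation_monoid M" "pointwise_closed M"
    and N: "transformation_monoid N" "pointwise_closed N"
    and cont: "continuous_map (End_topology orbit_signature (orbit_structure M))
      (End_topology orbit_signature (orbit_structure N)) h" and f: "f \<in> M"
  shows "\<exists>F. finite F \<and> (\<forall>g\<in>M. (\<forall>y\<in>F. g y = f y) \<longrightarrow> h g x = h f x)"
proof -
  have top: "End_topology orbit_signature (orbit_structure K) =
      subtopology (product_topology (\<lambda>_. discrete_topology UNIV) UNIV) K"
    if "transformation_monoid K" "pointwise_closed K" for K
    by (simp add: End_topology_def carrier_End_orbit_structure[OF that])
  let ?X = "\<lambda>_::nat. discrete_topology (UNIV :: nat set)"
  have "continuous_map (product_topology ?X UNIV) (discrete_topology UNIV) (\<lambda>k. k x)"
    by (rule continuous_map_product_projection) simp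
  then have "continuous_map (subtopology (product_topology ?X UNIV) N) (discrete_topology UNIV) (\<lambda>k. k x)"
    by (rule continuous_map_from_subtopology)
  from continuous_map_compose[OF cont[unfolded top[OF M] top[OF N]] this]
  have "continuous_map (subtopology (product_topology ?X UNIV) M) (discrete_topology UNIV) (\<lambda>g. h g x)"
    by (simp add: o_def)
  then have "openin (subtopology (product_topology ?X UNIV) M)
      {g \<in> topspace (subtopology (product_topology ?X UNIV) M). h g x \<in> {h f x}}"
    by (rule openin_continuous_map_preimage) simp
  then obtain U where U: "openin (product_topology ?X UNIV) U" "{g \<in> M. h g x = h f x} = U \<inter> M"
    by (auto simp: openin_subtopology)
  then have "f \<in> U" using f by blast
  then obtain W where W: "finite {i. W i \<noteq> UNIV}" "f \<in> Pi\<^sub>E UNIV W" "Pi\<^sub>E UNIV W \<subseteq> U"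
    using U(1) unfolding openin_product_topology_alt by force
  show ?thesis
  proof (intro exI conjI ballI impI)
    show "finite {i. W i \<noteq> UNIV}" by (rule W)
    fix g assume g: "g \<in> M" "\<forall>y\<in>{i. W i \<noteq> UNIV}. g y = f y"
    have "g y \<in> W y" for y
      using g(2) W(2) by (cases "W y = UNIV") (auto simp: PiE_iff)
    then have "g \<in> U" using W(3) by (auto simp: PiE_iff)
    then show "h g x = h f x" using g(1) U(2) by blast
  qed
qed

text \<open>Conjugation by a bijection with the natural numbers turns both monoids into endomorphism
  monoids of orbit structures. It remains to find closed oligomorphic monoids on a convenient
  countable set, and to refute continuity in its elementary finite form.\<close>

theorem End_monoids_from_closed_monoids:
  fixes M N :: "('x::countable \<Rightarrow> 'x) set"
  assumes inf: "infinite (UNIV :: 'x set)"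
    and M: "transformation_monoid M" "pointwise_closed M" "oligomorphic (unit_group M)"
    and N: "transformation_monoid N" "pointwise_closed N" "oligomorphic (unit_group N)"
    and iso: "bij_betw \<phi> M N" "\<And>f g. f \<in> M \<Longrightarrow> g \<in> M \<Longrightarrow> \<phi> (f \<circ> g) = \<phi> f \<circ> \<phi> g"
    and discontinuous: "\<And>\<psi>. bij_betw \<psi> M N \<Longrightarrow>
      (\<And>f g. f \<in> M \<Longrightarrow> g \<in> M \<Longrightarrow> \<psi> (f \<circ> g) = \<psi> f \<circ> \<psi> g) \<Longrightarrow>
      (\<And>f x. f \<in> M \<Longrightarrow> \<exists>F. finite F \<and> (\<forall>g\<in>M. (\<forall>y\<in>F. g y = f y) \<longrightarrow> \<psi> g x = \<psi> f x)) \<Longrightarrow> False"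
  shows "\<exists>(S :: (nat, nat) signature) (T :: (nat, nat) signature)
     (A :: (nat, nat, nat) fo_structure) (B :: (nat, nat, nat) fo_structure).
     omega_categorical S A \<and> omega_categorical T B \<and>
     End_monoid S A \<cong> End_monoid T B \<and>
     \<not> (\<exists>h \<in> iso (End_monoid S A) (End_monoid T B).
          homeomorphic_map (End_topology S A) (End_topology T B) h)"
proof -
  define b :: "'x \<Rightarrow> nat" where "b = to_nat_on UNIV"
  have b: "bij b" unfolding b_def by (rule to_nat_on_infinite) (simp_all add: inf)
  define a where "a = inv_into UNIV b"
  have inv: "a (b x) = x" "b (a y) = y" for x y
    using b by (simp_all add: a_def bij_is_inj bij_is_surj surj_f_inv_f)
  define c where "c m = b \<circ> m \<circ> a" for m
  define d where "d m = a \<circ> m \<circ> b" for m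
  have dc: "d (c m) = m" and cd: "c (d k) = k" for m k
    by (simp_all add: c_def d_def fun_eq_iff inv)
  have c_comp: "c (f \<circ> g) = c f \<circ> c g" for f g by (simp add: c_def fun_eq_iff inv)
  have d_comp: "d (f \<circ> g) = d f \<circ> d g" for f g by (simp add: d_def fun_eq_iff inv)
  have closed: "transformation_monoid (c ` K)" "pointwise_closed (c ` K)" "oligomorphic (unit_group (c ` K))"
    if "transformation_monoid K" "pointwise_closed K" "oligomorphic (unit_group K)" for K
    using transformation_monoid_conj[OF b] pointwise_closed_conj[OF b] oligomorphic_conj[OF b] that
    unfolding c_def a_def by blast+
  note cM = closed[OF M] and cN = closed[OF N]
  let ?A = "orbit_structure (c ` M)" and ?B = "orbit_structure (c ` N)"
  let ?EA = "End_monoid orbit_signature ?A" and ?EB = "End_monoid orbit_signature ?B"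
  have bij_c: "bij_betw c K (c ` K)" for K by (rule bij_betwI[of _ _ _ d]) (auto simp: dc)
  have bij_d: "bij_betw d (c ` K) K" for K by (rule bij_betwI[of _ _ _ c]) (auto simp: dc)
  have "bij_betw (c \<circ> (\<phi> \<circ> d)) (c ` M) (c ` N)"
    using bij_betw_trans[OF bij_betw_trans[OF bij_d iso(1)] bij_c] .
  then have "c \<circ> (\<phi> \<circ> d) \<in> iso ?EA ?EB"
    using iso(2) bij_betwE[OF iso(1)]
    by (auto simp: iso_def hom_def carrier_End_orbit_structure cM cN mult_End_orbit_structure
      bij_betw_def c_comp d_comp dc)
  then have "?EA \<cong> ?EB" by (auto simp: is_iso_def)
  moreover have "\<not> (\<exists>h\<in>iso ?EA ?EB. homeomorphic_map (End_topology orbit_signature ?A)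
      (End_topology orbit_signature ?B) h)"
  proof
    assume "\<exists>h\<in>iso ?EA ?EB. homeomorphic_map (End_topology orbit_signature ?A)
      (End_topology orbit_signature ?B) h"
    then obtain h where h: "h \<in> iso ?EA ?EB" and
      cont: "continuous_map (End_topology orbit_signature ?A) (End_topology orbit_signature ?B) h"
      by (auto simp: homeomorphic_imp_continuous_map)
    have bij_h: "bij_betw h (c ` M) (c ` N)"
      using h by (simp add: iso_def carrier_End_orbit_structure cM cN)
    have mult_h: "h (f \<circ> g) = h f \<circ> h g" if "f \<in> c ` M" "g \<in> c ` M" for f g
      using h that
      by (auto simp: iso_def hom_def carrier_End_orbit_structure cM cN mult_End_orbit_structure)
    show False
    proof (rule discontinuous)
      show "bij_betw (d \<circ> (h \<circ> c)) M N"
        using bij_betw_trans[OF bij_betw_trans[OF bij_c bij_h] bij_d] .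
      show "(d \<circ> (h \<circ> c)) (f \<circ> g) = (d \<circ> (h \<circ> c)) f \<circ> (d \<circ> (h \<circ> c)) g"
        if "f \<in> M" "g \<in> M" for f g
        using that by (simp add: c_comp d_comp mult_h)
      fix f x assume f: "f \<in> M"
      obtain F where F: "finite F" "\<forall>g\<in>c ` M. (\<forall>y\<in>F. g y = c f y) \<longrightarrow> h g (b x) = h (c f) (b x)"
        using continuous_End_pointwise[OF cM(1,2) cN(1,2) cont] f by blast
      have "(d \<circ> (h \<circ> c)) g x = (d \<circ> (h \<circ> c)) f x" if "g \<in> M" "\<forall>y\<in>a ` F. g y = f y" for g
      proof -
        have "\<forall>y\<in>F. c g y = c f y" using that by (simp add: c_def)
        then have "h (c g) (b x) = h (c f) (b x)" using F that by blast
        then show ?thesis by (simp add: d_def)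
      qed
      then show "\<exists>F. finite F \<and> (\<forall>g\<in>M. (\<forall>y\<in>F. g y = f y) \<longrightarrow>
          (d \<circ> (h \<circ> c)) g x = (d \<circ> (h \<circ> c)) f x)"
        using F(1) by (intro exI[of _ "a ` F"]) simp
    qed
  qed
  ultimately show ?thesis
    using omega_categorical_orbit_structure cM cN by blast
qed

section \<open>Two monoids that differ only topologically\<close>

datatype point = Centre | Src nat | Tgt bool nat

instance point :: countable
  by countable_datatype

lemma infinite_points: "infinite (UNIV :: point set)"
proof -
  have "inj Src" by (simp add: inj_def)
  then have "infinite (range Src)" by (simp add: finite_image_iff)
  then show ?thesis by (rule infinite_super[OF subset_UNIV])
qed

primrec diag :: "(nat \<Rightarrow> nat) \<Rightarrow> point \<Rightarrow> point" where
  "diag e Centre = Centre"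
| "diag e (Src q) = Src (e q)"
| "diag e (Tgt i q) = Tgt i (e q)"

primrec arrow :: "bool \<Rightarrow> (nat \<Rightarrow> nat) \<Rightarrow> point \<Rightarrow> point" where
  "arrow i n Centre = Centre"
| "arrow i n (Src q) = Tgt i (n q)"
| "arrow i n (Tgt j q) = Centre"

definition collapse :: "point \<Rightarrow> point" where
  "collapse x = Centre"

text \<open>\<open>r k\<close> is the target of the flips by \<open>{Suc k}\<close>. Sizes start at
  1 because \<open>flips {0}\<close> equals \<open>flips {}\<close>.\<close>

definition arrow_monoid :: "(nat \<Rightarrow> bool) \<Rightarrow> (point \<Rightarrow> point) set" where
  "arrow_monoid r = {collapse} \<union> diag ` flips {} \<union> (\<Union>i. arrow i ` flips {}) \<union>
    (\<Union>k. arrow (r k) ` flips {Suc k})"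

lemma arrow_monoidE:
  assumes "m \<in> arrow_monoid r"
  obtains "m = collapse" | e where "m = diag e" "e \<in> flips {}"
  | i n where "m = arrow i n" "n \<in> flips {}"
  | k n where "m = arrow (r k) n" "n \<in> flips {Suc k}"
  using assms unfolding arrow_monoid_def by blast

lemma arrow_monoidI:
  "collapse \<in> arrow_monoid r"
  "e \<in> flips {} \<Longrightarrow> diag e \<in> arrow_monoid r"
  "n \<in> flips {} \<Longrightarrow> arrow i n \<in> arrow_monoid r"
  "n \<in> flips {Suc k} \<Longrightarrow> arrow (r k) n \<in> arrow_monoid r"
  unfolding arrow_monoid_def by blast+

lemma compose_maps [simp]:
  "diag e \<circ> diag f = diag (e \<circ> f)"
  "diag e \<circ> arrow i n = arrow i (e \<circ> n)"
  "arrow i n \<circ> diag e = arrow i (n \<circ> e)"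
  "arrow i m \<circ> arrow j n = collapse"
  "collapse \<circ> u = collapse"
  "diag e \<circ> collapse = collapse"
  "arrow i n \<circ> collapse = collapse"
proof -
  have ext: "f = g" if "f Centre = g Centre" "\<And>q. f (Src q) = g (Src q)" "\<And>i q. f (Tgt i q) = g (Tgt i q)"
    for f g :: "point \<Rightarrow> point"
  proof
    fix x show "f x = g x" using that by (cases x) auto
  qed
  show "diag e \<circ> diag f = diag (e \<circ> f)"
    "diag e \<circ> arrow i n = arrow i (e \<circ> n)"
    "arrow i n \<circ> diag e = arrow i (n \<circ> e)"
    "arrow i m \<circ> arrow j n = collapse"
    "collapse \<circ> u = collapse"
    "diag e \<circ> collapse = collapse"
    "arrow i n \<circ> collapse = collapse"
    by (rule ext; simp add: collapse_def)+
qed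

lemma diag_id: "diag id = id"
proof
  fix x show "diag id x = id x" by (cases x) auto
qed

lemma maps_distinct [simp]:
  "diag e \<noteq> collapse" "arrow i n \<noteq> collapse" "diag e \<noteq> arrow i n"
  "collapse \<noteq> diag e" "collapse \<noteq> arrow i n" "arrow i n \<noteq> diag e"
proof -
  have "diag e (Src 0) = Src (e 0)" "arrow i n (Src 0) = Tgt i (n 0)" "collapse (Src 0) = Centre"
    by (simp_all add: collapse_def)
  then show "diag e \<noteq> collapse" "arrow i n \<noteq> collapse" "diag e \<noteq> arrow i n"
    "collapse \<noteq> diag e" "collapse \<noteq> arrow i n" "arrow i n \<noteq> diag e"
    by (metis point.distinct)+
qed

lemma arrow_eq_iff [simp]: "arrow i m = arrow j n \<longleftrightarrow> i = j \<and> m = n"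
proof
  assume "arrow i m = arrow j n"
  then have "arrow i m (Src q) = arrow j n (Src q)" for q by simp
  then show "i = j \<and> m = n" by (simp add: fun_eq_iff)
qed simp

lemma diag_in_arrow_monoid: "diag e \<in> arrow_monoid r \<Longrightarrow> e \<in> flips {}"
proof -
  assume "diag e \<in> arrow_monoid r"
  then obtain f where "diag e = diag f" and f: "f \<in> flips {}"
    by (rule arrow_monoidE) auto
  then have "diag e (Src q) = diag f (Src q)" for q by simp
  then have "e = f" by (auto simp: fun_eq_iff)
  then show ?thesis using f by simp
qed

lemma transformation_monoid_arrow_monoid: "transformation_monoid (arrow_monoid r)"
  unfolding transformation_monoid_def
proof (intro conjI ballI)
  show "id \<in> arrow_monoid r"
    using arrow_monoidI(2)[OF id_in_flips] by (simp add: diag_id)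
  fix f g assume "f \<in> arrow_monoid r" and g: "g \<in> arrow_monoid r"
  then show "f \<circ> g \<in> arrow_monoid r"
    by (elim arrow_monoidE; use g in \<open>elim arrow_monoidE; simp add: arrow_monoidI comp_flips_left comp_flips_right\<close>)
qed

section \<open>Closedness of the monoids\<close>

lemma pointwise_closed_flips: "pointwise_closed (flips c)"
  unfolding pointwise_closed_def
proof (intro allI impI)
  fix n :: "nat \<Rightarrow> nat"
  assume approx: "\<forall>F. finite F \<longrightarrow> (\<exists>f\<in>flips c. \<forall>x\<in>F. f x = n x)"
  show "n \<in> flips c"
    unfolding flips_def
  proof (intro CollectI conjI allI impI)
    show "inj n"
    proof (rule injI)
      fix p q assume eq: "n p = n q"
      have "finite {p, q}" by simp
      then obtain f where "f \<in> flips c" "\<forall>x\<in>{p, q}. f x = n x" using approx by blast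
      then have "inj f" "f p = f q" using eq by (simp_all add: flips_def)
      then show "p = q" by (rule injD)
    qed
    fix S :: "nat set" assume S: "finite S" "S \<noteq> {}"
    obtain f where f: "f \<in> flips c" "\<forall>x\<in>S. f x = n x" using approx S by blast
    have "f ` S = n ` S" using f(2) by (intro image_cong) auto
    then show "edge (n ` S) \<longleftrightarrow> edge S \<noteq> (card S \<in> c)"
      using edge_image_flip[OF f(1) S] by simp
  qed
qed

text \<open>The value at \<open>Src 0\<close> reveals whether approximating maps are zero, diagonal
  or arrows to a given target, so a limit stays within one kind. For arrows it remains to see that
  the flipped size cannot vary along the approximation.\<close>

lemma pointwise_closed_arrow_monoid: "pointwise_closed (arrow_monoid r)"
  unfolding pointwise_closed_def
proof (intro allI impI)
  fix h :: "point \<Rightarrow> point"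
  assume "\<forall>F. finite F \<longrightarrow> (\<exists>m\<in>arrow_monoid r. \<forall>x\<in>F. m x = h x)"
  then have approx: "\<exists>m\<in>arrow_monoid r. m (Src 0) = h (Src 0) \<and> (\<forall>x\<in>F. m x = h x)"
    if F: "finite F" for F
    using F by (metis finite_insert insert_iff)
  show "h \<in> arrow_monoid r"
  proof (cases "h (Src 0)")
    case Centre
    have "h x = Centre" for x
    proof -
      obtain m where m: "m \<in> arrow_monoid r" "m (Src 0) = Centre" "m x = h x"
        using approx[of "{x}"] Centre by auto
      from m(1,2) have "m = collapse" by (elim arrow_monoidE) auto
      then show ?thesis using m by (simp add: collapse_def)
    qed
    then have "h = collapse" by (simp add: fun_eq_iff collapse_def)
    then show ?thesis by (simp add: arrow_monoidI)
  next
    case (Src q0)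
    have diag: "\<exists>e\<in>flips {}. \<forall>x\<in>F. diag e x = h x" if F: "finite F" for F
    proof -
      obtain m where m: "m \<in> arrow_monoid r" "m (Src 0) = Src q0" "\<forall>x\<in>F. m x = h x"
        using approx[OF F] Src by auto
      from m(1,2) obtain e where "m = diag e" "e \<in> flips {}"
        by (elim arrow_monoidE) (auto simp: collapse_def)
      then show ?thesis using m by auto
    qed
    have "\<exists>p. h (Src q) = Src p" for q
      using diag[of "{Src q}"] by (metis diag.simps(2) finite.simps insertI1)
    then obtain e where e: "\<And>q. h (Src q) = Src (e q)" by metis
    have "h = diag e"
    proof
      fix x
      \<comment> \<open>For a target point \<open>x\<close>, the approximation is also taken at the
        source point with the same label, which links the value at \<open>x\<close> to
        \<open>e\<close>.\<close>
      obtain f where "\<forall>y\<in>{x, Src 0} \<union> Src ` (case x of Tgt i q \<Rightarrow> {q} | _ \<Rightarrow> {}). diag f y = h y"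
        using diag[of "{x, Src 0} \<union> Src ` (case x of Tgt i q \<Rightarrow> {q} | _ \<Rightarrow> {})"]
        by (auto split: point.splits)
      then show "h x = diag e x" using e by (cases x) auto
    qed
    moreover have "e \<in> flips {}"
    proof -
      have "\<exists>f\<in>flips {}. \<forall>q\<in>S. f q = e q" if S: "finite S" for S
        using diag[of "Src ` S"] S by (simp add: e)
      then show ?thesis by (rule pointwise_closedD[OF pointwise_closed_flips])
    qed
    ultimately show ?thesis using arrow_monoidI(2)[of e r] by simp
  next
    case (Tgt i q0)
    have arrow: "\<exists>n c. arrow i n \<in> arrow_monoid r \<and> n \<in> flips c \<and> (c = {} \<or> (\<exists>k. c = {Suc k} \<and> i = r k)) \<and>
        (\<forall>x\<in>F. arrow i n x = h x)" if F: "finite F" for F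
    proof -
      obtain m where m: "m \<in> arrow_monoid r" "m (Src 0) = Tgt i q0" "\<forall>x\<in>F. m x = h x"
        using approx[OF F] Tgt by auto
      from m(1) show ?thesis
      proof (cases rule: arrow_monoidE)
        case (3 j n)
        then show ?thesis using m by auto
      next
        case (4 k n)
        then show ?thesis using m by auto
      qed (use m in \<open>auto simp: collapse_def\<close>)
    qed
    have "\<exists>p. h (Src q) = Tgt i p" for q
      using arrow[of "{Src q}"] by (metis arrow.simps(2) finite.simps insertI1)
    then obtain n where n: "\<And>q. h (Src q) = Tgt i (n q)" by metis
    have "h x = arrow i n x" for x
      using arrow[of "{x}"] n by (cases x) auto
    then have h: "h = arrow i n" by (simp add: fun_eq_iff)
    have local: "\<exists>m c. m \<in> flips c \<and> (c = {} \<or> (\<exists>k. c = {Suc k} \<and> i = r k)) \<and> (\<forall>x\<in>S. m x = n x)"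
      if S: "finite S" for S
      using arrow[of "Src ` S"] S by (simp add: h) blast
    show ?thesis
    proof (cases "n \<in> flips {}")
      case True
      then show ?thesis by (simp add: h arrow_monoidI)
    next
      case False
      moreover have "inj n"
      proof (rule injI)
        fix p q assume eq: "n p = n q"
        obtain m c where m: "m \<in> flips c" "m p = n p" "m q = n q"
          using local[of "{p, q}"] by auto
        then have "inj m" "m p = m q" using eq by (simp_all add: flips_def)
        then show "p = q" by (rule injD)
      qed
      \<comment> \<open>Since \<open>n\<close> is not a self-embedding, it changes the status of
        some \<open>S0\<close>. Every approximation that agrees with \<open>n\<close> on
        \<open>S0\<close> must then flip the size of \<open>S0\<close>, which leaves a single
        \<open>k\<close>.\<close>
      ultimately obtain S0 where S0: "finite S0" "S0 \<noteq> {}" "edge (n ` S0) \<noteq> edge S0"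
        by (auto simp: flips_def)
      define k where "k = card S0 - 1"
      have card: "card S0 = Suc k" using S0 by (simp add: k_def card_gt_0_iff)
      have uniform: "i = r k \<and> (\<exists>m\<in>flips {Suc k}. \<forall>x\<in>S. m x = n x)" if S: "finite S" for S
      proof -
        obtain m c where m: "m \<in> flips c" "c = {} \<or> (\<exists>k. c = {Suc k} \<and> i = r k)"
            "\<forall>x\<in>S0 \<union> S. m x = n x"
          using local[of "S0 \<union> S"] S0(1) S by auto
        have "m ` S0 = n ` S0" using m(3) by (intro image_cong) auto
        then have "Suc k \<in> c" using edge_image_flip[OF m(1) S0(1,2)] S0(3) by (auto simp: card)
        then show ?thesis using m by auto
      qed
      then have "n \<in> flips {Suc k}"
        by (intro pointwise_closedD[OF pointwise_closed_flips]) blast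
      then show ?thesis using uniform[of "{}"] arrow_monoidI(4)[of n k r] by (simp add: h)
    qed
  qed
qed

section \<open>Oligomorphicity of the unit groups\<close>

primrec label :: "point \<Rightarrow> nat" where
  "label Centre = 0"
| "label (Src q) = q"
| "label (Tgt i q) = q"

text \<open>Setting all labels to 0 retains just the copy in which a point lies; copy and label
  together determine the point.\<close>

lemma diag_eqI: "diag (\<lambda>_. 0) x = diag (\<lambda>_. 0) y \<Longrightarrow> e (label x) = label y \<Longrightarrow> diag e x = y"
  by (cases x; cases y) auto

lemma diag_in_unit_group:
  assumes "bij e" "e \<in> flips {}"
  shows "diag e \<in> unit_group (arrow_monoid r)"
proof -
  have "e \<circ> inv_into UNIV e = id" "inv_into UNIV e \<circ> e = id"
    using assms(1) by (simp_all add: bij_def surj_iff[THEN iffD1] inj_iff[THEN iffD1])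
  then have "diag e \<circ> diag (inv_into UNIV e) = id" "diag (inv_into UNIV e) \<circ> diag e = id"
    by (simp_all add: diag_id)
  then show ?thesis
    using inv_in_flips[OF assms] assms(2) arrow_monoidI(2)[of _ r] unfolding unit_group_def by blast
qed

text \<open>The code of a tuple records the copies of its entries, the equalities between their
  labels and the edges among the labels; for fixed length there are finitely many codes. Equal codes
  make the labels a partial embedding, whose bijective extension \<open>e\<close> gives a unit
  \<open>diag e\<close> between the tuples.\<close>

lemma oligomorphic_arrow_monoid: "oligomorphic (unit_group (arrow_monoid r))"
  unfolding oligomorphic_def
proof
  fix n
  let ?G = "unit_group (arrow_monoid r)"
  define shape where "shape = diag (\<lambda>_. 0)"
  define code where "code xs = (map shape xs,
      {(i, j) \<in> {..<n} \<times> {..<n}. label (xs ! i) = label (xs ! j)},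
      {I \<in> Pow {..<n}. edge ((\<lambda>i. label (xs ! i)) ` I)})" for xs
  have sub: "(\<lambda>g. map g ys) ` ?G \<subseteq> (\<lambda>g. map g xs) ` ?G"
    if len: "length xs = n" "length ys = n" and code: "code xs = code ys" for xs ys
  proof -
    have shape: "map shape xs = map shape ys"
      and lab: "label (xs ! i) = label (xs ! j) \<longleftrightarrow> label (ys ! i) = label (ys ! j)"
        if "i < n" "j < n" for i j
      using code that by (auto simp: code_def set_eq_iff)
    have edg: "edge ((\<lambda>i. label (xs ! i)) ` I) \<longleftrightarrow> edge ((\<lambda>i. label (ys ! i)) ` I)" if "I \<subseteq> {..<n}" for I
      using code that by (auto simp: code_def set_eq_iff)
    define pr where "pr i = (label (xs ! i), label (ys ! i))" for i
    have "partial_flip {} (pr ` {..<n})"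
      unfolding partial_flip_def
    proof (intro conjI allI impI)
      show "\<forall>x\<in>pr ` {..<n}. \<forall>y\<in>pr ` {..<n}. (fst x = fst y) = (snd x = snd y)"
        using lab by (auto simp: pr_def)
      fix s assume "s \<subseteq> pr ` {..<n}"
      then obtain I where "I \<subseteq> {..<n}" "s = pr ` I" by (meson subset_imageE)
      then show "edge (snd ` s) \<longleftrightarrow> edge (fst ` s) \<noteq> (card s \<in> {})"
        using edg by (simp add: image_image pr_def)
    qed
    then obtain e where e: "bij e" "e \<in> flips {}" "\<And>x. x \<in> pr ` {..<n} \<Longrightarrow> e (fst x) = snd x"
      using partial_flip_extends by (metis finite_imageI finite_lessThan)
    have ys: "map (diag e) xs = ys"
    proof (rule nth_equalityI)
      fix i assume "i < length (map (diag e) xs)"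
      then have i: "i < n" using len by simp
      have "shape (xs ! i) = shape (ys ! i)"
        using shape[OF i i] len i by (metis nth_map)
      moreover have "e (label (xs ! i)) = label (ys ! i)"
        using e(3)[of "pr i"] i by (simp add: pr_def)
      ultimately have "diag e (xs ! i) = ys ! i" unfolding shape_def by (rule diag_eqI)
      then show "map (diag e) xs ! i = ys ! i" using i len by simp
    qed (use len in simp)
    show ?thesis
    proof (rule image_subsetI)
      fix g assume g: "g \<in> ?G"
      have "g \<circ> diag e \<in> ?G"
        using unit_group_comp[OF transformation_monoid_arrow_monoid g diag_in_unit_group[OF e(1,2)]] .
      moreover have "map g ys = map (g \<circ> diag e) xs" by (simp flip: ys)
      ultimately show "map g ys \<in> (\<lambda>g. map g xs) ` ?G" by (intro image_eqI[of _ _ "g \<circ> diag e"])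
    qed
  qed
  define W where "W = {Centre, Src 0, Tgt False 0, Tgt True 0}"
  have "shape x \<in> W" for x
    by (cases x) (auto simp: shape_def W_def)
  then have "code ` {xs. length xs = n} \<subseteq>
      {zs. set zs \<subseteq> W \<and> length zs = n} \<times> Pow ({..<n} \<times> {..<n}) \<times> Pow (Pow {..<n})"
    unfolding code_def by auto
  moreover have "finite W" by (simp add: W_def)
  ultimately have "finite (code ` {xs. length xs = n})"
    by (elim finite_subset) (simp add: finite_lists_length_eq)
  then show "finite ((\<lambda>xs. (\<lambda>g. map g xs) ` ?G) ` {xs. length xs = n})"
  proof (rule finite_image_coarser)
    fix xs ys assume "xs \<in> {xs. length xs = n}" "ys \<in> {xs. length xs = n}" "code xs = code ys"
    then show "(\<lambda>g. map g xs) ` ?G = (\<lambda>g. map g ys) ` ?G"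
      using sub[of xs ys] sub[of ys xs] by (intro subset_antisym) simp_all
  qed
qed

section \<open>The abstract isomorphism\<close>

definition strip :: "(point \<Rightarrow> point) \<Rightarrow> nat \<Rightarrow> nat" where
  "strip m q = label (m (Src q))"

text \<open>A flip by \<^term>\<open>{Suc k}\<close> determines \<^term>\<open>k\<close>, so its target copy can be changed
  from \<^term>\<open>s k\<close> to \<^term>\<open>r k\<close> without affecting any product.\<close>

definition retag :: "(nat \<Rightarrow> bool) \<Rightarrow> (point \<Rightarrow> point) \<Rightarrow> point \<Rightarrow> point" where
  "retag r m = (if (\<exists>i n. m = arrow i n) \<and> (\<exists>k. strip m \<in> flips {Suc k})
    then arrow (r (THE k. strip m \<in> flips {Suc k})) (strip m) else m)"

lemma strip_arrow [simp]: "strip (arrow i n) = n"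
  by (simp add: strip_def fun_eq_iff)

lemma retag_simps [simp]:
  "retag r (diag e) = diag e"
  "retag r collapse = collapse"
  "n \<in> flips {} \<Longrightarrow> retag r (arrow i n) = arrow i n"
  "n \<in> flips {Suc k} \<Longrightarrow> retag r (arrow i n) = arrow (r k) n"
proof -
  show "retag r (diag e) = diag e" "retag r collapse = collapse"
    by (simp_all add: retag_def)
  show "retag r (arrow i n) = arrow i n" if "n \<in> flips {}"
  proof -
    have "n \<notin> flips {Suc j}" for j using flips_eq[OF that, of "{Suc j}"] by auto
    then show ?thesis by (simp add: retag_def)
  qed
  assume n: "n \<in> flips {Suc k}"
  moreover have "j = k" if "n \<in> flips {Suc j}" for j using flips_eq[OF n that] by simp
  ultimately have "(THE j. n \<in> flips {Suc j}) = k" by (rule the_equality)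
  then show "retag r (arrow i n) = arrow (r k) n" using n by (auto simp: retag_def)
qed

lemma retag_in: "m \<in> arrow_monoid s \<Longrightarrow> retag r m \<in> arrow_monoid r"
  by (elim arrow_monoidE) (simp_all add: arrow_monoidI)

lemma retag_retag: "m \<in> arrow_monoid s \<Longrightarrow> retag s (retag r m) = m"
  by (elim arrow_monoidE) simp_all

lemma bij_betw_retag: "bij_betw (retag r) (arrow_monoid s) (arrow_monoid r)"
  by (rule bij_betwI[of _ _ _ "retag s"]) (auto simp: retag_in retag_retag)

text \<open>Multiplying an arrow by a diagonal element preserves the flipped sizes, hence the new
  target, and two arrows multiply to zero whatever their targets are.\<close>

lemma retag_comp:
  assumes "f \<in> arrow_monoid s" "g \<in> arrow_monoid s"
  shows "retag r (f \<circ> g) = retag r f \<circ> retag r g"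
  using assms(1)
  by (elim arrow_monoidE; use assms(2) in \<open>elim arrow_monoidE; simp add: comp_flips_left comp_flips_right\<close>)

section \<open>Failure of continuity\<close>

text \<open>The element \<^term>\<open>arrow True id\<close> commutes with the diagonal part, and its multiples by
  the diagonal part form an open set in the second monoid. In the first monoid the only arrows that
  commute with the diagonal part are \<^term>\<open>arrow i id\<close>, and both are limits of other arrows.\<close>

lemma no_continuous_isomorphism:
  assumes bij: "bij_betw \<psi> (arrow_monoid even) (arrow_monoid (\<lambda>_. False))"
    and mult: "\<And>f g. f \<in> arrow_monoid even \<Longrightarrow> g \<in> arrow_monoid even \<Longrightarrow> \<psi> (f \<circ> g) = \<psi> f \<circ> \<psi> g"
    and cont: "\<And>f x. f \<in> arrow_monoid even \<Longrightarrow>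
      \<exists>F. finite F \<and> (\<forall>g\<in>arrow_monoid even. (\<forall>y\<in>F. g y = f y) \<longrightarrow> \<psi> g x = \<psi> f x)"
  shows False
proof -
  let ?M = "arrow_monoid even" and ?N = "arrow_monoid (\<lambda>_. False)"
  have in_N: "\<psi> f \<in> ?N" if "f \<in> ?M" for f using bij that by (rule bij_betw_apply)
  have inj: "\<psi> f = \<psi> g \<longleftrightarrow> f = g" if "f \<in> ?M" "g \<in> ?M" for f g
    using bij that by (auto simp: bij_betw_def inj_on_eq_iff)
  have surj: "\<exists>f\<in>?M. \<psi> f = g" if "g \<in> ?N" for g
    using bij that unfolding bij_betw_def by (metis image_iff)
  \<comment> \<open>An algebraic description of the diagonal part: its elements are those with
    nonzero square. Hence \<open>\<psi>\<close> respects it.\<close>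
  have square: "f \<circ> f \<noteq> collapse \<longleftrightarrow> (\<exists>e. f = diag e)" if "f \<in> arrow_monoid r" for f r
    using that by (elim arrow_monoidE) auto
  have comp_in: "f \<circ> g \<in> ?M" if "f \<in> ?M" "g \<in> ?M" for f g
    using that transformation_monoid_comp[OF transformation_monoid_arrow_monoid] by blast
  have coll: "collapse \<in> ?M" by (rule arrow_monoidI)
  have "\<psi> collapse = collapse"
  proof -
    obtain z where z: "z \<in> ?M" "\<psi> z = collapse" using surj arrow_monoidI(1) by blast
    have "\<psi> collapse = \<psi> (z \<circ> collapse)"
      using z(1) by (elim arrow_monoidE) simp_all
    also have "\<dots> = collapse" by (simp add: mult z coll)
    finally show ?thesis .
  qed
  then have diag_iff: "(\<exists>e. \<psi> f = diag e) \<longleftrightarrow> (\<exists>e. f = diag e)" if f: "f \<in> ?M" for f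
    using square[OF f] square[OF in_N[OF f]] mult[OF f f] inj[OF comp_in[OF f f] coll] by simp
  \<comment> \<open>In the second monoid all flips by some \<open>{Suc k}\<close> go to
    \<open>False\<close>, so every arrow to \<open>True\<close> is a diagonal multiple of
    \<open>arrow True id\<close>.\<close>
  obtain y where y: "y \<in> ?M" "\<psi> y = arrow True id"
    using surj[OF arrow_monoidI(3)[OF id_in_flips]] by blast
  have "y \<noteq> collapse" using y(2) \<open>\<psi> collapse = collapse\<close> by auto
  moreover have "\<nexists>e. y = diag e" using diag_iff[OF y(1)] y(2) by auto
  ultimately obtain i n where yin: "y = arrow i n"
    using y(1) by (elim arrow_monoidE) auto
  have "n \<circ> e = e \<circ> n" if e: "e \<in> flips {}" for e
  proof -
    have de: "diag e \<in> ?M" using e by (rule arrow_monoidI)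
    then obtain f where "\<psi> (diag e) = diag f" using diag_iff by blast
    then have "\<psi> (y \<circ> diag e) = \<psi> (diag e \<circ> y)"
      by (simp add: mult y de del: compose_maps) simp
    then have "y \<circ> diag e = diag e \<circ> y" using inj comp_in y de by blast
    then show ?thesis by (simp add: yin)
  qed
  then have "n = id" by (rule commuting_eq_id)
  obtain F where F: "finite F"
    "\<And>g. g \<in> ?M \<Longrightarrow> (\<forall>x\<in>F. g x = y x) \<Longrightarrow> \<psi> g (Src 0) = \<psi> y (Src 0)"
    using cont[OF y(1), of "Src 0"] by blast
  obtain b where b: "\<And>q. q \<in> label ` F \<Longrightarrow> q < b"
    using F(1) finite_nat_iff_bounded by (metis finite_imageI lessThan_iff subsetD)
  \<comment> \<open>The parity sends flips by \<open>{Suc k}\<close> to the target \<open>i\<close>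
    of \<open>y\<close> in the first monoid, and \<open>k \<ge> b\<close> lets such a flip fix all
    labels occurring in \<open>F\<close>.\<close>
  define k where "k = (if i then 2 * b else Suc (2 * b))"
  have k: "even k = i" "b \<le> k" by (auto simp: k_def)
  obtain g where g: "g \<in> flips {Suc k}" "\<And>q. q < k \<Longrightarrow> g q = q" using flip_near_identity[of k] by blast
  have gM: "arrow i g \<in> ?M" using arrow_monoidI(4)[OF g(1), of even] k(1) by simp
  have "arrow i g x = y x" if "x \<in> F" for x
  proof -
    have "label x < k" using b[of "label x"] that k(2) by simp
    then show ?thesis using g(2) by (cases x) (simp_all add: yin \<open>n = id\<close>)
  qed
  \<comment> \<open>Continuity keeps the image close to \<open>arrow True id\<close>: its value at
    \<open>Src 0\<close> lies in the target \<open>True\<close>, which only arrows from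
    self-embeddings reach.\<close>
  then have "\<psi> (arrow i g) (Src 0) = Tgt True 0" using F(2)[OF gM] y(2) by simp
  with in_N[OF gM] obtain e where e: "\<psi> (arrow i g) = arrow True e" "e \<in> flips {}"
    by (elim arrow_monoidE) (auto simp: collapse_def)
  \<comment> \<open>Pulling \<open>arrow True e = diag e \<circ> arrow True id\<close> back along
    \<open>\<psi>\<close> makes \<open>arrow i g\<close> a diagonal multiple of
    \<open>y = arrow i id\<close>, so \<open>g\<close> would be a self-embedding.\<close>
  obtain u where u: "u \<in> ?M" "\<psi> u = diag e" using surj[OF arrow_monoidI(2)[OF e(2)]] by blast
  then obtain f where f: "u = diag f" using diag_iff by blast
  have "\<psi> (arrow i g) = \<psi> (u \<circ> y)" by (simp add: mult u y e del: compose_maps(1))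
  then have "arrow i g = u \<circ> y" using inj gM comp_in u(1) y(1) by blast
  then have "g = f" by (simp add: f yin \<open>n = id\<close>)
  then have "g \<in> flips {}" using diag_in_arrow_monoid u(1) f by blast
  then show False using flips_eq[OF g(1), of "{}"] by simp
qed

theorem theorem1p1:
  "\<exists>(S :: (nat, nat) signature) (T :: (nat, nat) signature)
     (A :: (nat, nat, nat) fo_structure) (B :: (nat, nat, nat) fo_structure).
     omega_categorical S A \<and> omega_categorical T B \<and>
     End_monoid S A \<cong> End_monoid T B \<and>
     \<not> (\<exists>h \<in> iso (End_monoid S A) (End_monoid T B).
          homeomorphic_map (End_topology S A) (End_topology T B) h)"
proof (rule End_monoids_from_closed_monoids)
  show "bij_betw (retag (\<lambda>_. False)) (arrow_monoid even) (arrow_monoid (\<lambda>_. False))"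
    by (rule bij_betw_retag)
  show "retag (\<lambda>_. False) (f \<circ> g) = retag (\<lambda>_. False) f \<circ> retag (\<lambda>_. False) g"
    if "f \<in> arrow_monoid even" "g \<in> arrow_monoid even" for f g
    using that by (rule retag_comp)
qed (use infinite_points transformation_monoid_arrow_monoid pointwise_closed_arrow_monoid
    oligomorphic_arrow_monoid no_continuous_isomorphism in blast)+

end
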